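(* Let $q$ be a prime power with $q\equiv1\pmod 4$ and let $d$ be an odd positive integer with $q\equiv-1\pmod d$. Let $s=\nu_2(q-1)$ (so $s\ge2$). Fix a primitive $2^s$-th root of unity $\alpha_{2^s}\in\mathbb{F}_q^*$ and put $\alpha_{2^k}=\alpha_{2^s}^{2^{s-k}}$ for $1\le k\le s$ (so $\alpha_2=-1$, $\alpha_{2^{k-1}}=\alpha_{2^k}^2$); fix $\beta_{2^{s+1}}\in\mathbb{F}_{q^2}$ with $\beta_{2^{s+1}}^2=\alpha_{2^s}$. Let $\gamma$ be a primitive $d$-th root of unity in $\mathbb{F}_{q^2}$ and set $\delta_j=\gamma^j+\gamma^{qj}$, $\theta_j=\gamma^j-\gamma^{qj}$. (i) If $2\le n\le s$, then $x^{2^nd}-1$ is the product of $2^{n-1}(d+1)$ monic irreducible factors over $\mathbb{F}_q$ given by $$x^{2^nd}-1=(x-1)(x+1)\prod_{j=1}^{(d-1)/2}\left(x^2\pm\delta_jx+1\right)\prod_{k=2}^{n}\prod_{i=1}^{2^{k-2}}\left[\left(x\pm\alpha_{2^k}^{2i-1}\right)\prod_{j=1}^{(d-1)/2}\left(x^2\pm\alpha_{2^k}^{2i-1}\delta_jx+\alpha_{2^{k-1}}^{2i-1}\right)\right].$$ (ii) If $n>s$, then $x^{2^nd}-1$ is the product of $2^{s-1}((n-s+1)d+1)$ monic irreducible factors over $\mathbb{F}_q$ given by $$x^{2^nd}-1=(x^{2^sd}-1)\prod_{r=1}^{n-s}\prod_{i=1}^{2^{s-2}}\left[\left(x^{2^r}\pm\alpha_{2^s}^{2i-1}\right)\prod_{j=1}^{(d-1)/2}\prod_{l=0}^{1}\left(x^{2^r}\pm\alpha_4^{l}\beta_{2^{s+1}}^{2i-1}\theta_jx^{2^{r-1}}-\alpha_2^{l}\alpha_{2^s}^{2i-1}\right)\right],$$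 where $x^{2^sd}-1$ is factored into irreducibles as in (i) with $n=s$.
   Context: $\nu_2(l)$ is the exponent of the largest power of $2$ dividing $l$. Notation: $(A\pm B)$ denotes $(A+B)(A-B)$; e.g. $(x^2\pm ux+v)=(x^2+ux+v)(x^2-ux+v)$ and $(x^{2^r}\pm ux^{2^{r-1}}+v)=(x^{2^r}+ux^{2^{r-1}}+v)(x^{2^r}-ux^{2^{r-1}}+v)$. *)

theory Defs
  imports
    "HOL-Library.Cardinality"
    "HOL-Number_Theory.Cong"
    "HOL-Number_Theory.Prime_Powers"
    "Subresultants.Resultant_Prelim"
begin

definition primitive_root_of_unity :: "nat \<Rightarrow> 'a::field \<Rightarrow> bool" where
  "primitive_root_of_unity m z \<longleftrightarrow> m > 0 \<and> z ^ m = 1 \<and> (\<forall>k. 0 < k \<and> k < m \<longrightarrow> z ^ k \<noteq> 1)"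

text \<open>The convention \<open>(A \<plusminus> B) = (A + B)(A - B)\<close>. A trinomial \<open>(x\<^sup>2 \<plusminus> u x + v)\<close> is
  \<open>pm (x\<^sup>2 + v) (u x)\<close>.\<close>

definition pm :: "'a::comm_ring_1 \<Rightarrow> 'a \<Rightarrow> 'a" where
  "pm A B = (A + B) * (A - B)"

definition pm_factors :: "'a::comm_ring_1 \<Rightarrow> 'a \<Rightarrow> 'a multiset" where
  "pm_factors A B = {#A + B, A - B#}"

abbreviation polyx :: "'a::comm_semiring_1 poly" where
  "polyx \<equiv> [:0, 1:]"

text \<open>The factors displayed in the factorization of \<open>x^(2^n d) - 1\<close> for \<open>2 \<le> n \<le> s\<close>, collected
  with multiplicity; \<open>a k\<close> stands for \<open>\<alpha>\<close> with index \<open>2^k\<close>.\<close>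

definition factors_low :: "(nat \<Rightarrow> 'b::field) \<Rightarrow> (nat \<Rightarrow> 'b) \<Rightarrow> nat \<Rightarrow> nat \<Rightarrow> 'b poly multiset" where
  "factors_low a \<delta> d n =
     {#polyx - 1, polyx + 1#}
     + (\<Sum>j = 1..(d - 1) div 2. pm_factors (polyx ^ 2 + 1) ([:\<delta> j:] * polyx))
     + (\<Sum>k = 2..n. \<Sum>i = 1..2 ^ (k - 2).
          pm_factors polyx [:a k ^ (2 * i - 1):]
          + (\<Sum>j = 1..(d - 1) div 2.
               pm_factors (polyx ^ 2 + [:a (k - 1) ^ (2 * i - 1):])
                          ([:a k ^ (2 * i - 1) * \<delta> j:] * polyx)))"

text \<open>The further factors that appear for \<open>n > s\<close>, that is, those of the cofactor of
  \<open>x^(2^s d) - 1\<close>; \<open>\<beta>\<close> is a square root of \<open>a s\<close>.\<close>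

definition factors_high ::
  "(nat \<Rightarrow> 'b::field) \<Rightarrow> 'b \<Rightarrow> (nat \<Rightarrow> 'b) \<Rightarrow> nat \<Rightarrow> nat \<Rightarrow> nat \<Rightarrow> 'b poly multiset" where
  "factors_high a \<beta> \<theta> d s n =
     (\<Sum>r = 1..n - s. \<Sum>i = 1..2 ^ (s - 2).
        pm_factors (polyx ^ (2 ^ r)) [:a s ^ (2 * i - 1):]
        + (\<Sum>j = 1..(d - 1) div 2. \<Sum>l = 0..1.
             pm_factors (polyx ^ (2 ^ r) - [:a 1 ^ l * a s ^ (2 * i - 1):])
                        ([:a 2 ^ l * \<beta> ^ (2 * i - 1) * \<theta> j:] * polyx ^ (2 ^ (r - 1)))))"

text \<open>Here \<open>\<iota>\<close> embeds the base field into an extension field, in which the factors \<open>F\<close> are written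
  down. The predicate says that the members of \<open>F\<close> are in fact polynomials over the base field, that
  over it they are monic and irreducible with product \<open>p\<close>, and that their number is \<open>N\<close>.\<close>

definition monic_irreducible_factorization ::
  "('a::field \<Rightarrow> 'b::field) \<Rightarrow> 'a poly \<Rightarrow> 'b poly multiset \<Rightarrow> nat \<Rightarrow> bool" where
  "monic_irreducible_factorization \<iota> p F N \<longleftrightarrow>
     (\<exists>G. image_mset (map_poly \<iota>) G = F \<and>
          (\<forall>g \<in># G. lead_coeff g = 1 \<and> Factorial_Ring.irreducible g) \<and>
          prod_mset G = p \<and> size G = N)"

end

theory Submission
  imports "HOL-Number_Theory.Residues" Defs
begin

text \<open>
  Since \<open>\<gamma>^q = \<gamma>^-1\<close>, the linear factors of \<open>X^d - y^d = \<Prod>(X - y \<gamma>^j)\<close> pair up into the quadratics with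
  coefficients \<open>\<delta>\<^sub>j\<close>; telescoping \<open>Z^(2^t) - 1 = (Z - 1) \<Prod>(Z^(2^k) + 1)\<close> and splitting each
  \<open>Z^(2^k) + 1\<close> by odd powers of a root of unity gives the product formulas. In the second part the
  same pairing is applied to \<open>\<gamma>^4\<close>, also a primitive \<open>d\<close>-th root of unity.

  The quadratics have roots \<open>A \<noteq> A^q\<close> in the extension, so they descend to irreducibles. Every factor
  of higher degree arises from a linear or quadratic one by substituting \<open>x^2\<close> for \<open>x\<close> repeatedly.
  If \<open>g\<close> is monic irreducible, \<open>-1\<close> is a square and \<open>g(x\<^sup>2) = u v\<close>, then the norms
  \<open>U(x\<^sup>2) = u(x) u(-x)\<close> and \<open>V\<close> satisfy \<open>U V = g\<^sup>2\<close>; a proper factorization forces \<open>U\<close> to be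
  associated to \<open>g\<close>, and comparing constant and leading coefficients makes \<open>g(0)\<close> a square. Here
  \<open>g(0)\<close> is an odd power of \<open>\<alpha>\<close> with index \<open>2^s\<close>, which is not a square in the base field.
\<close>

subsection \<open>Substituting a square into an irreducible polynomial\<close>

lemma poly_even_odd_decomposition:
  fixes p :: "'a::comm_ring_1 poly"
  obtains e o' where "p = pcompose e (polyx ^ 2) + polyx * pcompose o' (polyx ^ 2)"
proof -
  have "\<exists>e o'. p = pcompose e (polyx ^ 2) + polyx * pcompose o' (polyx ^ 2)"
  proof (induction p)
    case 0
    show ?case by (intro exI[of _ 0]) simp
  next
    case (pCons a p)
    then obtain e o' where p: "p = pcompose e (polyx ^ 2) + polyx * pcompose o' (polyx ^ 2)"
      by blast
    have "pCons a p = [:a:] + polyx * p"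
      by simp
    also have "\<dots> = pcompose (pCons a o') (polyx ^ 2) + polyx * pcompose e (polyx ^ 2)"
      by (subst p) (simp add: pcompose_pCons algebra_simps power2_eq_square)
    finally show ?case by blast
  qed
  with that show ?thesis by blast
qed

text \<open>This is the norm from polynomials in \<open>x\<close> down to polynomials in
  \<open>x ^ 2\<close>. Splitting \<open>u\<close> into even and odd parts \<open>e\<close> and
  \<open>o'\<close>, the conjugate under \<open>x -> -x\<close> flips the odd part, so the product
  is \<open>e ^ 2 - y * o' ^ 2\<close> at \<open>y = x ^ 2\<close>. The odd part does not reach the
  constant term, hence the square.\<close>

lemma poly_square_norm:
  fixes u :: "'a::comm_ring_1 poly"
  obtains U where "pcompose U (polyx ^ 2) = u * pcompose u (- polyx)"
    and "coeff U 0 = (coeff u 0)\<^sup>2"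
proof -
  obtain e o' where u: "u = pcompose e (polyx ^ 2) + polyx * pcompose o' (polyx ^ 2)"
    by (rule poly_even_odd_decomposition)
  have "pcompose (polyx ^ 2) (- polyx) = (polyx ^ 2 :: 'a poly)"
    by (simp add: power2_eq_square pcompose_mult pcompose_pCons)
  hence neg: "pcompose u (- polyx) = pcompose e (polyx ^ 2) - polyx * pcompose o' (polyx ^ 2)"
    by (subst u) (simp add: pcompose_add pcompose_mult pcompose_pCons flip: pcompose_assoc)
  show ?thesis
  proof
    show "pcompose (e ^ 2 - polyx * o' ^ 2) (polyx ^ 2) = u * pcompose u (- polyx)"
      by (subst neg, subst u)
         (simp add: pcompose_diff pcompose_mult pcompose_pCons power2_eq_square algebra_simps)
    have "coeff u 0 = coeff e 0"
      by (subst u) (simp add: coeff_mult_0 power2_eq_square poly_0_coeff_0)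
    thus "coeff (e ^ 2 - polyx * o' ^ 2) 0 = (coeff u 0)\<^sup>2"
      by (simp add: power2_eq_square coeff_mult_0)
  qed
qed

lemma pcompose_square_cancel:
  fixes p r :: "'a::field poly"
  assumes "pcompose p (polyx ^ 2) = pcompose r (polyx ^ 2)"
  shows "p = r"
proof -
  have "pcompose (p - r) (polyx ^ 2) = 0"
    using assms by (simp add: pcompose_diff)
  moreover have "degree (polyx ^ 2 :: 'a poly) > 0"
    by (simp add: degree_power_eq)
  ultimately show ?thesis
    using pcompose_eq_0 by fastforce
qed

lemma irreducible_pcompose_square:
  fixes g :: "'a::field poly"
  assumes irr: "Factorial_Ring.irreducible g" and monic: "lead_coeff g = 1"
    and imag: "(i::'a)\<^sup>2 = -1"
    and nonsquare: "\<And>w. w\<^sup>2 \<noteq> coeff g 0"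
  shows "Factorial_Ring.irreducible (pcompose g (polyx ^ 2))"
proof (rule irreducibleI)
  have deg2: "degree (polyx ^ 2 :: 'a poly) = 2"
    by (simp add: degree_power_eq)
  have lc2: "lead_coeff (polyx ^ 2 :: 'a poly) = 1"
    by (simp only: lead_coeff_power) simp
  have g: "g \<noteq> 0" "degree g > 0"
    using irr by (auto simp: Factorial_Ring.irreducible_def is_unit_iff_degree)
  show nz: "pcompose g (polyx ^ 2) \<noteq> 0"
    using g pcompose_eq_0[of g "polyx ^ 2"] deg2 by auto
  show "\<not> is_unit (pcompose g (polyx ^ 2))"
    using g nz by (simp add: is_unit_iff_degree degree_pcompose deg2)
  fix u v assume uv: "pcompose g (polyx ^ 2) = u * v"
  hence nz': "u \<noteq> 0" "v \<noteq> 0" using nz by auto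
  obtain U where U: "pcompose U (polyx ^ 2) = u * pcompose u (- polyx)"
      "coeff U 0 = (coeff u 0)\<^sup>2"
    by (rule poly_square_norm)
  obtain V where V: "pcompose V (polyx ^ 2) = v * pcompose v (- polyx)"
      "coeff V 0 = (coeff v 0)\<^sup>2"
    by (rule poly_square_norm)
  \<comment> \<open>The leading coefficient of a norm is that of \<open>w\<close> squared, times
    \<open>(-1) ^ degree w\<close>. Here the square root \<open>i\<close> of -1 is needed: it turns
    the sign into a square.\<close>
  have deg_norm: "degree W = degree w \<and> (\<exists>c. lead_coeff W = c\<^sup>2 \<and> (w \<noteq> 0 \<longrightarrow> c \<noteq> 0))"
    if W: "pcompose W (polyx ^ 2) = w * pcompose w (- polyx)" for W w :: "'a poly"
  proof -
    have "degree (w * pcompose w (- polyx)) = degree w + degree w"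
      by (cases "w = 0") (simp_all add: degree_mult_eq degree_pcompose pcompose_eq_0_iff)
    hence deg: "degree W = degree w"
      using arg_cong[OF W, of degree] by (simp add: degree_pcompose deg2)
    have "lead_coeff W = lead_coeff (pcompose W (polyx ^ 2))"
      using lead_coeff_comp[of "polyx ^ 2" W] unfolding lc2 by (simp add: deg2)
    also have "\<dots> = (lead_coeff w)\<^sup>2 * (-1) ^ degree w"
      unfolding W lead_coeff_mult
      by (subst lead_coeff_comp) (simp_all add: power2_eq_square)
    also have "(-1) ^ degree w = (i ^ degree w)\<^sup>2"
      by (metis imag mult.commute power_mult)
    finally have "lead_coeff W = (lead_coeff w * i ^ degree w)\<^sup>2"
      by (simp add: power_mult_distrib)
    moreover have "i \<noteq> 0" using imag by auto
    ultimately show ?thesis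
      using deg by (intro conjI exI[of _ "lead_coeff w * i ^ degree w"]) auto
  qed
  \<comment> \<open>If a norm is a constant multiple of the monic \<open>g\<close>, the constant is
    the leading coefficient \<open>c ^ 2\<close> of the norm. Comparing constant terms then exhibits
    \<open>coeff g 0\<close> as the square of \<open>coeff w 0 / c\<close>.\<close>
  have not_assoc: False
    if W: "pcompose W (polyx ^ 2) = w * pcompose w (- polyx)" "coeff W 0 = (coeff w 0)\<^sup>2"
      and "W = g * k" "is_unit k" "w \<noteq> 0" for W w k :: "'a poly"
  proof -
    obtain c where c: "lead_coeff W = c\<^sup>2" "c \<noteq> 0"
      using deg_norm[OF W(1)] \<open>w \<noteq> 0\<close> by blast
    obtain b where b: "k = [:b:]"
      using \<open>is_unit k\<close> by (auto simp: is_unit_poly_iff elim: degree_eq_zeroE)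
    have "b = c\<^sup>2"
      using c(1) monic lead_coeff_mult[of g k] unfolding \<open>W = g * k\<close> b by simp
    hence "(coeff w 0)\<^sup>2 = coeff g 0 * c\<^sup>2"
      using W(2) \<open>W = g * k\<close> b by (simp add: mult.commute)
    hence "(coeff w 0 / c)\<^sup>2 = coeff g 0"
      using c(2) by (simp add: power_divide)
    with nonsquare show False by blast
  qed
  \<comment> \<open>The product of the two norms is \<open>g(x^2)\<close> times its conjugate, and
    \<open>g(x^2)\<close> is invariant under \<open>x -> -x\<close>. Cancelling the substitution
    leaves \<open>U * V = g * g\<close>.\<close>
  have "pcompose (U * V) (polyx ^ 2) = pcompose g (polyx ^ 2) * pcompose (pcompose g (polyx ^ 2)) (- polyx)"
    by (simp add: pcompose_mult U V uv mult_ac)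
  also have "pcompose (pcompose g (polyx ^ 2)) (- polyx) = pcompose g (polyx ^ 2)"
    by (simp add: power2_eq_square pcompose_mult pcompose_pCons flip: pcompose_assoc)
  finally have "pcompose (U * V) (polyx ^ 2) = pcompose (g * g) (polyx ^ 2)"
    by (simp add: pcompose_mult)
  hence UV: "U * V = g * g"
    by (rule pcompose_square_cancel)
  have unit: "is_unit w" if "W dvd 1" "pcompose W (polyx ^ 2) = w * pcompose w (- polyx)" "w \<noteq> 0"
    for W w :: "'a poly"
    using that deg_norm[OF that(2)] by (metis is_unit_iff_degree not_is_unit_0)
  \<comment> \<open>\<open>g\<close> is prime, so it divides a norm, say \<open>U = g * k\<close>.
    Then \<open>g = k * V\<close>: a unit \<open>k\<close> is excluded by \<open>not_assoc\<close>,
    so \<open>V\<close> is a unit, and so is \<open>v\<close>, because norms preserve the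
    degree.\<close>
  have "g dvd U \<or> g dvd V"
    using field_poly_irreducible_imp_prime[OF irr] UV prime_elem_dvd_multD by (metis dvd_triv_left)
  thus "is_unit u \<or> is_unit v"
  proof
    assume "g dvd U"
    then obtain k where k: "U = g * k" ..
    hence "g = k * V" using UV g by (simp add: mult_ac)
    hence "is_unit k \<or> is_unit V" using irr irreducibleD by blast
    thus ?thesis using not_assoc[OF U k] unit[OF _ V(1)] nz' by blast
  next
    assume "g dvd V"
    then obtain k where k: "V = g * k" ..
    hence "g = k * U" using UV g by (simp add: mult_ac)
    hence "is_unit k \<or> is_unit U" using irr irreducibleD by blast
    thus ?thesis using not_assoc[OF V k] unit[OF _ U(1)] nz' by blast
  qed
qed

subsection \<open>Roots of unity and products of linear factors\<close>

lemma primitive_root_of_unity_power_eq_1_iff: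
  assumes "primitive_root_of_unity m z"
  shows "z ^ k = 1 \<longleftrightarrow> m dvd k"
proof
  assume "z ^ k = 1"
  have "z ^ k = (z ^ m) ^ (k div m) * z ^ (k mod m)"
    by (metis mult_div_mod_eq power_add power_mult)
  hence "z ^ (k mod m) = 1"
    using assms \<open>z ^ k = 1\<close> by (simp add: primitive_root_of_unity_def)
  moreover have "k mod m < m"
    using assms by (simp add: primitive_root_of_unity_def)
  ultimately show "m dvd k"
    using assms by (auto simp: primitive_root_of_unity_def dvd_eq_mod_eq_0)
next
  assume "m dvd k"
  thus "z ^ k = 1"
    using assms by (auto simp: primitive_root_of_unity_def power_mult)
qed

lemma primitive_root_of_unity_power_eq_iff:
  assumes z: "primitive_root_of_unity m z" and "j \<le> k"
  shows "z ^ j = z ^ k \<longleftrightarrow> m dvd k - j"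
proof -
  have "z \<noteq> 0"
    using z by (auto simp: primitive_root_of_unity_def power_0_left)
  hence "z ^ j = z ^ k \<longleftrightarrow> z ^ (k - j) = 1"
    using \<open>j \<le> k\<close> by (auto simp: power_diff)
  thus ?thesis
    by (simp add: primitive_root_of_unity_power_eq_1_iff[OF z])
qed

lemma primitive_root_of_unity_power_coprime:
  assumes z: "primitive_root_of_unity m z" and "coprime k m"
  shows "primitive_root_of_unity m (z ^ k)"
  using assms
  by (auto simp: primitive_root_of_unity_def[of _ "z ^ k"] primitive_root_of_unity_power_eq_1_iff[OF z]
      coprime_dvd_mult_right_iff coprime_commute dest: dvd_imp_le simp flip: power_mult)
     (simp add: primitive_root_of_unity_def)

lemma primitive_root_of_unity_power_dvd:
  assumes z: "primitive_root_of_unity (m * k) z"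
  shows "primitive_root_of_unity m (z ^ k)"
  using z
  by (auto simp: primitive_root_of_unity_def[of _ "z ^ k"] primitive_root_of_unity_power_eq_1_iff[OF z]
      dest: dvd_imp_le simp flip: power_mult)
     (auto simp: primitive_root_of_unity_def dest: dvd_imp_le)

text \<open>For \<open>X = polyx\<close> both sides are monic of degree \<open>m\<close> and vanish
  at the \<open>m\<close> points \<open>y * z ^ i\<close>, which are distinct when \<open>y\<close>
  is nonzero; this determines them. Composition with \<open>X\<close> gives the general
  form.\<close>

lemma prod_minus_roots_of_unity:
  fixes X :: "'a::field poly"
  assumes z: "primitive_root_of_unity m z"
  shows "(\<Prod>i<m. X - [:y * z ^ i:]) = X ^ m - [:y ^ m:]"
proof (cases "y = 0")
  case True
  thus ?thesis using z by (simp add: primitive_root_of_unity_def power_0_left)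
next
  case False
  have m: "m > 0" using z by (simp add: primitive_root_of_unity_def)
  have inj: "inj_on (\<lambda>i. y * z ^ i) {..<m}"
  proof (rule linorder_inj_onI')
    fix i j assume "i \<in> {..<m}" "j \<in> {..<m}" "i < j"
    thus "y * z ^ i \<noteq> y * z ^ j"
      using False primitive_root_of_unity_power_eq_iff[OF z, of i j]
      by (auto dest: dvd_imp_le)
  qed
  have "(\<Prod>i<m. polyx - [:y * z ^ i:]) = polyx ^ m - [:y ^ m:]" (is "?l = ?r")
  proof (rule poly_eqI_degree_lead_coeff[of _ m])
    have deg: "degree ?l = m"
      by (simp add: degree_prod_eq_sum_degree)
    have "lead_coeff ?l = 1"
      by (simp only: lead_coeff_prod) simp
    moreover have "coeff (polyx ^ m :: 'a poly) m = 1"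
      using lead_coeff_power[of "polyx :: 'a poly" m] by (simp add: degree_power_eq)
    ultimately show "coeff ?l m = coeff ?r m"
      using m deg by (simp add: coeff_pCons split: nat.splits)
    show "degree ?l \<le> m" using deg by simp
    show "degree ?r \<le> m"
      by (rule degree_diff_le) (simp_all add: degree_power_eq)
    show "m \<le> card ((\<lambda>i. y * z ^ i) ` {..<m})"
      using inj by (simp add: card_image)
    fix w assume "w \<in> (\<lambda>i. y * z ^ i) ` {..<m}"
    then obtain i where i: "i < m" "w = y * z ^ i" by auto
    have "w ^ m = y ^ m * (z ^ m) ^ i"
      by (simp add: i power_mult_distrib mult.commute flip: power_mult)
    hence "w ^ m = y ^ m" using z by (simp add: primitive_root_of_unity_def)
    moreover have "poly ?l w = 0"
      using i by (auto simp: poly_prod intro!: prod_zero)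
    ultimately show "poly ?l w = poly ?r w" by simp
  qed
  hence "pcompose (\<Prod>i<m. polyx - [:y * z ^ i:]) X = pcompose (polyx ^ m - [:y ^ m:]) X"
    by simp
  thus ?thesis
    by (simp add: pcompose_prod pcompose_diff pcompose_pCons pcompose_hom.hom_power
        del: diff_pCons)
qed

text \<open>Raising to the power \<open>q\<close> inverts every power of \<open>z\<close>, since
  \<open>d\<close> divides \<open>q + 1\<close>. Conjugation over the field of order
  \<open>q\<close> therefore acts on these roots as inversion.\<close>

lemma primitive_root_of_unity_mult_conjugate:
  assumes z: "primitive_root_of_unity d z" and "d dvd q + 1"
  shows "z ^ j * z ^ (q * j) = 1"
proof -
  have "z ^ j * z ^ (q * j) = z ^ ((q + 1) * j)"
    by (simp add: power_add algebra_simps)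
  also have "\<dots> = 1"
    unfolding primitive_root_of_unity_power_eq_1_iff[OF z] using \<open>d dvd q + 1\<close> by (rule dvd_mult2)
  finally show ?thesis .
qed

lemma primitive_root_of_unity_conjugate_twice:
  assumes "primitive_root_of_unity d z" and "d dvd q + 1"
  shows "z ^ (q * (q * j)) = z ^ j"
  using primitive_root_of_unity_mult_conjugate[OF assms, of j]
    primitive_root_of_unity_mult_conjugate[OF assms, of "q * j"]
  by (metis mult.commute mult_cancel_right mult_zero_right zero_neq_one)

text \<open>As \<open>d\<close> is odd, the nonzero exponents modulo \<open>d\<close> split into
  pairs \<open>j\<close>, \<open>d - j\<close>. The power \<open>z ^ (d - j)\<close> is the inverse
  of \<open>z ^ j\<close>, that is, \<open>z ^ (q * j)\<close>, so each pair is a conjugate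
  pair.\<close>

lemma prod_minus_roots_of_unity_pairs:
  fixes X :: "'a::field poly"
  assumes z: "primitive_root_of_unity d z" and "odd d" and "d dvd q + 1"
  shows "(X - [:y:]) * (\<Prod>j = 1..(d - 1) div 2. (X - [:y * z ^ j:]) * (X - [:y * z ^ (q * j):]))
           = X ^ d - [:y ^ d:]"
proof -
  define h where "h = (d - 1) div 2"
  have d: "d = 2 * h + 1" using \<open>odd d\<close> by (simp add: h_def)
  have inv: "z ^ (q * j) = z ^ (Suc (2 * h) - j)" if "j \<in> {1..h}" for j
  proof -
    have "z ^ j * z ^ (q * j) = 1"
      using z \<open>d dvd q + 1\<close> by (rule primitive_root_of_unity_mult_conjugate)
    moreover have "z ^ (Suc (2 * h) - j) * z ^ j = 1"
      using that z by (simp add: d primitive_root_of_unity_def flip: power_add)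
    ultimately show ?thesis
      by (metis mult.commute mult_cancel_right zero_neq_one mult_zero_right)
  qed
  have "X ^ d - [:y ^ d:] = (\<Prod>i<d. X - [:y * z ^ i:])"
    by (rule prod_minus_roots_of_unity[OF z, symmetric])
  also have "{..<d} = insert 0 ({1..h} \<union> {h+1..2*h})"
    by (auto simp: d)
  also have "(\<Prod>i\<in>\<dots>. X - [:y * z ^ i:])
      = (X - [:y:]) * ((\<Prod>i = 1..h. X - [:y * z ^ i:]) * (\<Prod>i = h+1..2*h. X - [:y * z ^ i:]))"
    by (subst prod.insert) (auto simp: prod.union_disjoint)
  also have "(\<Prod>i = h+1..2*h. X - [:y * z ^ i:]) = (\<Prod>j = 1..h. X - [:y * z ^ (Suc (2 * h) - j):])"
    by (rule prod.reindex_bij_witness[of _ "\<lambda>j. Suc (2 * h) - j" "\<lambda>j. Suc (2 * h) - j"]) auto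
  also have "\<dots> = (\<Prod>j = 1..h. X - [:y * z ^ (q * j):])"
    by (intro prod.cong refl) (simp add: inv)
  finally show ?thesis
    by (simp add: prod.distrib h_def)
qed

lemma primitive_root_of_unity_two_power_half:
  assumes b: "primitive_root_of_unity (2 ^ m) b" and "m \<ge> 1"
  shows "b ^ 2 ^ (m - 1) = -1"
proof -
  have m: "2 ^ m = (2::nat) ^ (m - 1) * 2"
    using \<open>m \<ge> 1\<close> by (cases m) simp_all
  have "(b ^ 2 ^ (m - 1))\<^sup>2 = 1"
    using b unfolding m by (simp add: primitive_root_of_unity_def power_mult)
  moreover have "b ^ 2 ^ (m - 1) \<noteq> 1"
    using b unfolding m by (auto simp: primitive_root_of_unity_def)
  ultimately show ?thesis
    by (simp add: power2_eq_1_iff)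
qed

text \<open>The odd powers are \<open>b * (b ^ 2) ^ i\<close>, and \<open>b ^ 2\<close> is a
  primitive root of order \<open>2 ^ (m - 1)\<close>. The product thus equals
  \<open>X ^ 2 ^ (m - 1) - b ^ 2 ^ (m - 1)\<close>, whose last term is -1.\<close>

lemma prod_minus_odd_powers:
  fixes X :: "'a::field poly"
  assumes b: "primitive_root_of_unity (2 ^ m) b" and "m \<ge> 1"
  shows "(\<Prod>i = 1..2 ^ (m - 1). X - [:b ^ (2 * i - 1):]) = X ^ 2 ^ (m - 1) + 1"
proof -
  have m: "2 ^ m = (2::nat) ^ (m - 1) * 2"
    using \<open>m \<ge> 1\<close> by (cases m) simp_all
  have "(\<Prod>i = 1..2 ^ (m - 1). X - [:b ^ (2 * i - 1):])
      = (\<Prod>i<2 ^ (m - 1). X - [:b * (b ^ 2) ^ i:])"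
    by (rule prod.reindex_bij_witness[of _ Suc "\<lambda>i. i - 1"])
       (auto simp flip: power_mult power_Suc simp: Suc_diff_Suc
        intro!: arg_cong[where f = "\<lambda>k. b ^ k"])
  also have "\<dots> = X ^ 2 ^ (m - 1) - [:b ^ 2 ^ (m - 1):]"
    by (rule prod_minus_roots_of_unity)
       (use primitive_root_of_unity_power_dvd[of "2 ^ (m - 1)" 2 b] b m in simp)
  finally show ?thesis
    unfolding primitive_root_of_unity_two_power_half[OF assms] by (simp add: one_pCons)
qed

lemma prod_two_power_plus_1:
  fixes Z :: "'a::comm_ring_1"
  shows "(Z - 1) * (\<Prod>k<t. Z ^ 2 ^ k + 1) = Z ^ 2 ^ t - 1"
proof (induction t)
  case (Suc t)
  have "(Z - 1) * (\<Prod>k<Suc t. Z ^ 2 ^ k + 1) = ((Z - 1) * (\<Prod>k<t. Z ^ 2 ^ k + 1)) * (Z ^ 2 ^ t + 1)"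
    by (simp add: mult.assoc)
  also have "\<dots> = Z ^ 2 ^ Suc t - 1"
    unfolding Suc.IH by (simp add: algebra_simps power_mult power2_eq_square flip: power_add)
  finally show ?case .
qed simp

subsection \<open>Descent from the extension field\<close>

text \<open>Multiplication by a nonzero \<open>x\<close> permutes the nonzero elements; comparing
  their products before and after gives exponent one less than the cardinality.\<close>

lemma finite_field_power_card:
  fixes x :: "'a::{field,finite}"
  shows "x ^ CARD('a) = x"
proof (cases "x = 0")
  case False
  have "(\<Prod>y\<in>UNIV-{0}. x * y) = (\<Prod>y\<in>UNIV-{0}. y)"
    by (rule prod.reindex_bij_witness[of _ "\<lambda>y. y / x" "\<lambda>y. x * y"]) (use False in auto)
  hence "x ^ (CARD('a) - 1) * \<Prod>(UNIV - {0}) = \<Prod>(UNIV - {0::'a})"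
    by (simp add: prod.distrib)
  hence "x ^ (CARD('a) - 1) = 1" by simp
  hence "x * x ^ (CARD('a) - 1) = x" by simp
  thus ?thesis by (simp flip: power_Suc)
qed simp

text \<open>The characteristic divides the cardinality \<open>q ^ k\<close>, so it is the prime of
  which \<open>q\<close> is a power, and raising to the power \<open>q\<close> is an iterate of the
  Frobenius map.\<close>

lemma finite_field_power_add:
  fixes x y :: "'b::{field,finite}"
  assumes "primepow q" and card: "CARD('b) = q ^ k"
  shows "(x + y) ^ q = x ^ q + y ^ q"
proof -
  have prime: "prime CHAR('b)"
    by (rule prime_CHAR_semidom) (simp add: finite_imp_CHAR_pos)
  obtain p e where pe: "prime p" "q = p ^ e"
    using \<open>primepow q\<close> by (auto simp: primepow_def)
  have "CHAR('b) dvd q ^ k"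
    using CHAR_dvd_CARD[where 'a = 'b] by (simp add: card)
  hence "CHAR('b) = p"
    using prime pe by (metis prime_dvd_power primes_dvd_imp_eq)
  with prime pe show ?thesis
    by (intro freshmans_dream') simp_all
qed

text \<open>The image consists of roots of \<open>x ^ CARD('a) - x\<close> and already has as many
  elements as that polynomial can have roots.\<close>

lemma range_field_hom_eq_frobenius_fixed:
  fixes \<iota> :: "'a::{field,finite} \<Rightarrow> 'b::field"
  assumes "field_hom \<iota>"
  shows "range \<iota> = {y. y ^ CARD('a) = y}"
proof (rule card_seteq)
  interpret field_hom \<iota> by fact
  show "range \<iota> \<subseteq> {y. y ^ CARD('a) = y}"
    by (auto simp: finite_field_power_card simp flip: hom_power)
  have card: "CARD('a) > 1"
    using card_mono[of "UNIV :: 'a set" "{0, 1}"] by simp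
  define f :: "'b poly" where "f = monom 1 (CARD('a)) - polyx"
  have "coeff f 1 = -1"
    using card by (simp add: f_def)
  hence "f \<noteq> 0" by auto
  have roots: "{y. y ^ CARD('a) = y} = {y. poly f y = 0}"
    by (simp add: f_def poly_monom)
  have "card {y. poly f y = 0} \<le> degree f"
    using \<open>f \<noteq> 0\<close> by (rule card_poly_roots_bound)
  also have "degree f \<le> CARD('a)"
    unfolding f_def using card by (intro degree_diff_le) (simp_all add: degree_monom_le)
  also have "CARD('a) = card (range \<iota>)"
    by (simp add: card_image inj_f)
  finally show "card {y :: 'b. y ^ CARD('a) = y} \<le> card (range \<iota>)"
    unfolding roots .
  show "finite {y :: 'b. y ^ CARD('a) = y}"
    unfolding roots using \<open>f \<noteq> 0\<close> by (rule poly_roots_finite)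
qed

text \<open>The condition that \<open>monic_irreducible_factorization\<close> puts on one factor,
  isolated so that the factors can be treated separately and reassembled.\<close>

definition descends_to_irreducible :: "('a::field \<Rightarrow> 'b::field) \<Rightarrow> 'b poly \<Rightarrow> bool" where
  "descends_to_irreducible \<iota> f \<longleftrightarrow>
     (\<exists>g. map_poly \<iota> g = f \<and> lead_coeff g = 1 \<and> Factorial_Ring.irreducible g)"

text \<open>A preimage is chosen for each factor. Since \<open>map_poly \<iota>\<close> is injective
  and multiplicative, the product formula over the extension pulls back to the base field.\<close>

lemma monic_irreducible_factorizationI:
  assumes "field_hom \<iota>" and "\<And>f. f \<in># F \<Longrightarrow> descends_to_irreducible \<iota> f"
    and "prod_mset F = map_poly \<iota> p" and "size F = N"
  shows "monic_irreducible_factorization \<iota> p F N"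
proof -
  interpret field_hom \<iota> by fact
  interpret map_poly_hom: map_poly_inj_idom_hom \<iota> ..
  obtain h where h: "\<And>f. f \<in># F \<Longrightarrow>
      map_poly \<iota> (h f) = f \<and> lead_coeff (h f) = 1 \<and> Factorial_Ring.irreducible (h f)"
    using assms(2) unfolding descends_to_irreducible_def by metis
  have img: "image_mset (map_poly \<iota>) (image_mset h F) = F"
    using h by (simp add: multiset.map_comp comp_def cong: image_mset_cong)
  have "map_poly \<iota> (prod_mset (image_mset h F)) = map_poly \<iota> p"
    unfolding map_poly_hom.hom_prod_mset img by fact
  hence "prod_mset (image_mset h F) = p"
    by simp
  with h img assms(4) show ?thesis
    unfolding monic_irreducible_factorization_def
    by (intro exI[of _ "image_mset h F"]) auto
qed

lemma descends_to_irreducible_linear: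
  assumes "field_hom \<iota>"
  shows "descends_to_irreducible \<iota> (polyx + [:\<iota> c:])"
proof -
  interpret field_hom \<iota> by fact
  show ?thesis
    unfolding descends_to_irreducible_def
    by (intro exI[of _ "[:c, 1:]"]) (simp add: irreducible_linear_field_poly)
qed

lemma descends_to_irreducible_pcompose_two_power:
  fixes \<iota> :: "'a::field \<Rightarrow> 'b::field"
  assumes "field_hom \<iota>" and "descends_to_irreducible \<iota> f" and imag: "(i::'a)\<^sup>2 = -1"
    and const: "coeff f 0 = \<iota> w" and nonsquare: "\<And>v. v\<^sup>2 \<noteq> w"
  shows "descends_to_irreducible \<iota> (pcompose f (polyx ^ 2 ^ r))"
proof -
  interpret field_hom \<iota> by fact
  interpret map_poly_hom: map_poly_inj_idom_hom \<iota> ..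
  obtain g where g: "map_poly \<iota> g = f" "lead_coeff g = 1" "Factorial_Ring.irreducible g"
    using assms(2) unfolding descends_to_irreducible_def by blast
  have "coeff g 0 = w"
    using const g(1) by auto
  \<comment> \<open>Substituting \<open>x ^ 2\<close> changes neither the leading nor the constant
    coefficient, so the hypotheses of \<open>irreducible_pcompose_square\<close> survive each round
    of the induction.\<close>
  have "lead_coeff (pcompose g (polyx ^ 2 ^ r)) = 1 \<and>
        coeff (pcompose g (polyx ^ 2 ^ r)) 0 = w \<and>
        Factorial_Ring.irreducible (pcompose g (polyx ^ 2 ^ r))"
  proof (induction r)
    case 0
    show ?case using g \<open>coeff g 0 = w\<close> by simp
  next
    case (Suc r)
    have eq: "pcompose g (polyx ^ 2 ^ Suc r) = pcompose (pcompose g (polyx ^ 2 ^ r)) (polyx ^ 2)"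
      by (simp add: pcompose_hom.hom_power pcompose_pCons flip: pcompose_assoc power_mult)
    have "lead_coeff (polyx ^ 2 :: 'a poly) = 1"
      by (simp only: lead_coeff_power) simp
    hence "lead_coeff (pcompose g (polyx ^ 2 ^ Suc r)) = 1"
      unfolding eq using Suc.IH lead_coeff_comp[of "polyx ^ 2" "pcompose g (polyx ^ 2 ^ r)"]
      by (simp add: degree_power_eq)
    moreover have "coeff (pcompose g (polyx ^ 2 ^ Suc r)) 0 = w"
      unfolding eq using Suc.IH by (simp add: power2_eq_square poly_0_coeff_0)
    moreover have "Factorial_Ring.irreducible (pcompose g (polyx ^ 2 ^ Suc r))"
      unfolding eq using Suc.IH imag nonsquare by (intro irreducible_pcompose_square) auto
    ultimately show ?case by blast
  qed
  moreover have "map_poly \<iota> (pcompose g (polyx ^ 2 ^ r)) = pcompose f (polyx ^ 2 ^ r)"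
    by (simp add: map_poly_pcompose map_poly_hom.hom_power g)
  ultimately show ?thesis
    unfolding descends_to_irreducible_def by blast
qed

lemma irreducible_quadratic:
  fixes g :: "'a::field poly"
  assumes "degree g = 2" and "\<And>r. poly g r \<noteq> 0"
  shows "Factorial_Ring.irreducible g"
proof (rule irreducibleI)
  show "g \<noteq> 0" "\<not> is_unit g"
    using assms(1) by (auto simp: is_unit_iff_degree)
  fix u v assume uv: "g = u * v"
  hence nz: "u \<noteq> 0" "v \<noteq> 0" using \<open>g \<noteq> 0\<close> by auto
  hence "degree u + degree v = 2"
    using assms(1) uv by (simp add: degree_mult_eq)
  moreover have "degree w \<noteq> 1" if "w dvd g" for w
  proof
    assume "degree w = 1"
    then obtain a b where w: "w = [:a, b:]" "b \<noteq> 0"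
      by (metis degree_eq_zeroE degree_pCons_eq_if one_neq_zero pCons_cases pCons_eq_0_iff Suc_inject One_nat_def)
    hence "poly w (- a / b) = 0" by simp
    hence "poly g (- a / b) = 0"
      using that by (auto simp: dvd_def)
    with assms(2) show False by blast
  qed
  hence "degree u \<noteq> 1" "degree v \<noteq> 1" using uv by simp_all
  ultimately have "degree u = 0 \<or> degree v = 0" by linarith
  thus "is_unit u \<or> is_unit v" using nz by (simp add: is_unit_iff_degree)
qed

text \<open>The power map swaps \<open>A\<close> and \<open>B\<close>, so their sum and product are
  fixed and lie in the image of the base field. The roots themselves are moved, hence lie outside
  it, and a quadratic without roots is irreducible.\<close>

lemma descends_to_irreducible_quadratic:
  fixes \<iota> :: "'a::{field,finite} \<Rightarrow> 'b::{field,finite}"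
  assumes "field_hom \<iota>" and "primepow q" and card: "CARD('a) = q" "CARD('b) = q ^ k"
    and conj: "A ^ q = B" "B ^ q = A" "A \<noteq> B"
  shows "descends_to_irreducible \<iota> ((polyx - [:A:]) * (polyx - [:B:]))"
proof -
  interpret field_hom \<iota> by fact
  interpret map_poly_hom: map_poly_inj_idom_hom \<iota> ..
  note range = range_field_hom_eq_frobenius_fixed[OF \<open>field_hom \<iota>\<close>, unfolded card(1)]
  have "(A + B) ^ q = A + B"
    unfolding finite_field_power_add[OF \<open>primepow q\<close> card(2)] by (simp add: conj add.commute)
  then obtain t where t: "\<iota> t = A + B"
    using range by (metis (mono_tags, lifting) mem_Collect_eq rangeE)
  have "(A * B) ^ q = A * B"
    by (simp add: power_mult_distrib conj mult.commute)
  then obtain m where m: "\<iota> m = A * B"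
    using range by (metis (mono_tags, lifting) mem_Collect_eq rangeE)
  have map: "map_poly \<iota> [:m, - t, 1:] = (polyx - [:A:]) * (polyx - [:B:])"
    by (simp add: t m hom_uminus)
  have "poly [:m, - t, 1:] r \<noteq> 0" for r
  proof
    assume "poly [:m, - t, 1:] r = 0"
    hence "poly (map_poly \<iota> [:m, - t, 1:]) (\<iota> r) = 0"
      unfolding poly_map_poly by simp
    hence "\<iota> r = A \<or> \<iota> r = B"
      unfolding map poly_mult mult_eq_0_iff by auto
    moreover have "\<iota> r ^ q = \<iota> r" using range by auto
    ultimately show False using conj by auto
  qed
  hence "Factorial_Ring.irreducible [:m, - t, 1:]"
    by (intro irreducible_quadratic) simp_all
  with map show ?thesis
    unfolding descends_to_irreducible_def by (intro exI[of _ "[:m, - t, 1:]"]) simp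
qed

subsection \<open>The displayed factors\<close>

lemma prod_mset_sum: "prod_mset (sum f A) = (\<Prod>x\<in>A. prod_mset (f x))"
  by (induction A rule: infinite_finite_induct) simp_all

lemma size_mset_sum: "size (sum f A :: 'a multiset) = (\<Sum>x\<in>A. size (f x))"
  by (induction A rule: infinite_finite_induct) simp_all

lemma prod_mset_pm_factors [simp]: "prod_mset (pm_factors A B) = pm A B"
  by (simp add: pm_factors_def pm_def)

lemma size_pm_factors [simp]: "size (pm_factors A B) = 2"
  by (simp add: pm_factors_def)

lemma set_pm_factors [simp]: "set_mset (pm_factors A B) = {A + B, A - B}"
  by (simp add: pm_factors_def)

lemma size_factors_low:
  assumes "odd d" and "n \<ge> 2"
  shows "size (factors_low a \<delta> d n) = 2 ^ (n - 1) * (d + 1)"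
proof -
  have pow: "1 + (\<Sum>k = 2..n. 2 ^ (k - 2)) = (2::nat) ^ (n - 1)"
    using \<open>n \<ge> 2\<close>
  proof (induction n rule: dec_induct)
    case (step n)
    then obtain m where "n = Suc (Suc m)" by (auto simp: le_iff_add)
    with step show ?case by simp
  qed simp
  obtain h where d: "d = 2 * h + 1"
    using \<open>odd d\<close> by (rule oddE)
  have "size (factors_low a \<delta> d n) = (2 * h + 2) * (1 + (\<Sum>k = 2..n. 2 ^ (k - 2)))"
    by (simp add: factors_low_def size_mset_sum d sum_distrib_left mult.commute)
  thus ?thesis
    unfolding pow by (simp add: d)
qed

lemma size_factors_high:
  assumes "odd d" and "s \<ge> 2"
  shows "size (factors_high a \<beta> \<theta> d s n) = 2 ^ (s - 1) * ((n - s) * d)"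
proof -
  have "2 ^ (s - 1) = 2 * (2::nat) ^ (s - 2)"
    using \<open>s \<ge> 2\<close> by (auto simp: le_iff_add)
  moreover obtain h where "d = 2 * h + 1"
    using \<open>odd d\<close> by (rule oddE)
  ultimately show ?thesis
    by (simp add: factors_high_def size_mset_sum algebra_simps)
qed

section \<open>Products of the trinomials belonging to a conjugate pair of roots of unity\<close>

lemma const_poly_ring_hom:
  fixes a b :: "'a::comm_ring_1"
  shows "[:a * b:] = [:a:] * [:b:]" "[:a + b:] = [:a:] + [:b:]"
    "[:- a:] = - [:a:]" "[:a ^ k:] = [:a:] ^ k"
  by (simp_all add: poly_const_pow)

lemma low_block_identity:
  fixes x y g h :: "'a::comm_ring_1"
  assumes "g * h = 1"
  shows "(x - y * g) * (x - y * h) = x ^ 2 + y ^ 2 - y * (g + h) * x"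
proof -
  have "(x - y * g) * (x - y * h) = x ^ 2 + y ^ 2 * (g * h) - y * (g + h) * x"
    by (simp add: algebra_simps power2_eq_square)
  thus ?thesis by (simp add: assms)
qed

text \<open>With \<open>g * h = 1\<close> the two pairs of trinomials multiply to
  \<open>Y ^ 4 + c ^ 4 - T\<close> and \<open>Y ^ 4 + c ^ 4 + T\<close>. Their product is a
  difference of squares in which the cross terms cancel, leaving only \<open>g ^ 4 + h ^ 4\<close>:
  this is where the fourth power of \<gamma> comes from.\<close>

lemma high_block_identity:
  fixes Y c i g h :: "'a::comm_ring_1"
  assumes gh: "g * h = 1" and i: "i ^ 2 = -1"
  shows "(Y ^ 2 - c ^ 2 + c * (g - h) * Y) * (Y ^ 2 - c ^ 2 - c * (g - h) * Y) *
         ((Y ^ 2 + c ^ 2 + i * c * (g - h) * Y) * (Y ^ 2 + c ^ 2 - i * c * (g - h) * Y))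
       = ((Y ^ 2) ^ 2 - (c ^ 2) ^ 2 * g ^ 4) * ((Y ^ 2) ^ 2 - (c ^ 2) ^ 2 * h ^ 4)"
    (is "?A * ?B = ?C")
proof -
  define T where "T = c ^ 2 * (g ^ 2 + h ^ 2) * Y ^ 2"
  \<comment> \<open>The multiple of \<open>g * h - 1\<close> is carried along so that this is an
    identity for arbitrary ring elements; only afterwards is it dropped.\<close>
  have "?A = Y ^ 4 + c ^ 4 - T + (g * h - 1) * (c ^ 2 * Y ^ 2 + c ^ 2 * Y ^ 2)"
    by (simp add: T_def algebra_simps power2_eq_square power4_eq_xxxx)
  hence 1: "?A = Y ^ 4 + c ^ 4 - T" by (simp add: gh)
  have "?B = Y ^ 4 + c ^ 4 + (c ^ 2 * Y ^ 2 + c ^ 2 * Y ^ 2) - i ^ 2 * (c ^ 2 * (g - h) ^ 2 * Y ^ 2)"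
    by (simp add: algebra_simps power2_eq_square power4_eq_xxxx)
  also have "\<dots> = Y ^ 4 + c ^ 4 + T - (g * h - 1) * (c ^ 2 * Y ^ 2 + c ^ 2 * Y ^ 2)"
    unfolding i by (simp add: T_def algebra_simps power2_eq_square)
  finally have 2: "?B = Y ^ 4 + c ^ 4 + T" by (simp add: gh)
  have "T * T = c ^ 4 * (g ^ 4 + (g * h) ^ 2 + (g * h) ^ 2 + h ^ 4) * Y ^ 4"
    by (simp add: T_def algebra_simps power2_eq_square power4_eq_xxxx)
  hence T2: "T * T = c ^ 4 * (g ^ 4 + 1 + 1 + h ^ 4) * Y ^ 4" by (simp add: gh)
  have "?A * ?B = (Y ^ 4 + c ^ 4) * (Y ^ 4 + c ^ 4) - T * T"
    unfolding 1 2 by (simp add: algebra_simps)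
  also have "\<dots> = Y ^ 4 * Y ^ 4 - c ^ 4 * Y ^ 4 * (g ^ 4 + h ^ 4) + c ^ 4 * c ^ 4"
    unfolding T2 by (simp add: algebra_simps)
  \<comment> \<open>Inserting \<open>(g * h) ^ 4 = 1\<close> gives the constant term of
    \<open>?C\<close>.\<close>
  also have "c ^ 4 * c ^ 4 = c ^ 4 * c ^ 4 * (g * h) ^ 4" by (simp add: gh)
  also have "Y ^ 4 * Y ^ 4 - c ^ 4 * Y ^ 4 * (g ^ 4 + h ^ 4) + \<dots> = ?C"
    by (simp add: algebra_simps power_mult_distrib flip: power_mult)
  finally show ?thesis .
qed

lemma low_quadratic_eq:
  fixes \<gamma> y :: "'b::field"
  assumes \<gamma>: "primitive_root_of_unity d \<gamma>" and "d dvd q + 1"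
    and \<delta>: "\<And>j. \<delta> j = \<gamma> ^ j + \<gamma> ^ (q * j)"
  shows "(polyx - [:y * \<gamma> ^ j:]) * (polyx - [:y * \<gamma> ^ (q * j):])
      = polyx ^ 2 + [:y\<^sup>2:] - [:y * \<delta> j:] * polyx"
proof -
  have "[:\<gamma> ^ j:] * [:\<gamma> ^ (q * j):] = 1"
    using primitive_root_of_unity_mult_conjugate[OF assms(1,2), of j]
    by (simp add: one_pCons mult.commute)
  thus ?thesis
    unfolding \<delta> const_poly_ring_hom(1,2,4) by (rule low_block_identity)
qed

text \<open>The two signs correspond to the pairing formula at \<open>y = - c\<close> and
  \<open>y = c\<close>. Since \<open>d\<close> is odd, \<open>(- c) ^ d = - (c ^ d)\<close>, and the
  two results form a difference of squares.\<close>

lemma prod_low_block: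
  fixes \<gamma> c :: "'b::field"
  assumes \<gamma>: "primitive_root_of_unity d \<gamma>" and "odd d" and "d dvd q + 1"
    and \<delta>: "\<And>j. \<delta> j = \<gamma> ^ j + \<gamma> ^ (q * j)"
  shows "pm polyx [:c:] * (\<Prod>j = 1..(d - 1) div 2. pm (polyx ^ 2 + [:c\<^sup>2:]) ([:c * \<delta> j:] * polyx))
           = polyx ^ (2 * d) - [:c ^ (2 * d):]"
proof -
  note pairs = prod_minus_roots_of_unity_pairs[OF \<gamma> \<open>odd d\<close> \<open>d dvd q + 1\<close>, where X = polyx]
  have "pm polyx [:c:] * (\<Prod>j = 1..(d - 1) div 2. pm (polyx ^ 2 + [:c\<^sup>2:]) ([:c * \<delta> j:] * polyx))
      = (polyx ^ d - [:c ^ d:]) * (polyx ^ d - [:(- c) ^ d:])"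
    unfolding pairs[symmetric] low_quadratic_eq[OF \<gamma> \<open>d dvd q + 1\<close> \<delta>]
    by (simp only: pm_def prod.distrib mult_minus_left const_poly_ring_hom(3)
        diff_minus_eq_add power2_minus) (simp only: mult_ac)
  also have "\<dots> = (polyx ^ d) ^ 2 - [:(c ^ d)\<^sup>2:]"
    using \<open>odd d\<close> by (simp add: power_minus_odd power2_eq_square algebra_simps)
  finally show ?thesis
    by (simp add: power_mult mult.commute)
qed

text \<open>For each \<open>j\<close> the values \<open>l = 0\<close> and \<open>l = 1\<close> give
  the two pairs of \<open>high_block_identity\<close>. What remains is the pairing formula for
  \<open>\<gamma> ^ 4\<close>, with \<open>X = (Y ^ 2) ^ 2\<close> and \<open>y = w ^ 2\<close>; the
  factor in front supplies its unpaired term.\<close>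

lemma prod_high_block:
  fixes \<gamma> c w :: "'b::field" and Y :: "'b poly"
  assumes \<gamma>: "primitive_root_of_unity d \<gamma>" and "odd d" and "d dvd q + 1"
    and \<theta>: "\<And>j. \<theta> j = \<gamma> ^ j - \<gamma> ^ (q * j)"
    and c: "c\<^sup>2 = w" and imag: "i\<^sup>2 = -1"
  shows "pm (Y ^ 2) [:w:] * (\<Prod>j = 1..(d - 1) div 2. \<Prod>l = 0..1.
             pm (Y ^ 2 - [:(-1) ^ l * w:]) ([:i ^ l * c * \<theta> j:] * Y))
           = (Y ^ 2) ^ (2 * d) - [:w ^ (2 * d):]"
proof -
  have "coprime 4 d"
    using \<open>odd d\<close> coprime_power_left_iff[of 2 2 d] by simp
  note \<gamma>4 = primitive_root_of_unity_power_coprime[OF \<gamma> this]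
  have quad: "(\<Prod>l = 0..1. pm (Y ^ 2 - [:(-1) ^ l * w:]) ([:i ^ l * c * \<theta> j:] * Y))
      = ((Y ^ 2) ^ 2 - [:w\<^sup>2 * (\<gamma> ^ 4) ^ j:]) * ((Y ^ 2) ^ 2 - [:w\<^sup>2 * (\<gamma> ^ 4) ^ (q * j):])" for j
  proof -
    \<comment> \<open>Constants are named as constant polynomials so that the abstract ring identity
      applies to them directly.\<close>
    define g h where "g = [:\<gamma> ^ j:]" and "h = [:\<gamma> ^ (q * j):]"
    define C I where "C = [:c:]" and "I = [:i:]"
    have gh: "g * h = 1"
      using primitive_root_of_unity_mult_conjugate[OF \<gamma> \<open>d dvd q + 1\<close>, of j] by (simp add: one_pCons mult.commute g_def h_def)
    have I: "I ^ 2 = - 1"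
      using imag by (simp add: I_def poly_const_pow one_pCons)
    have W: "[:w:] = C ^ 2"
      by (simp add: C_def poly_const_pow c)
    have g4: "[:(\<gamma> ^ 4) ^ j:] = g ^ 4"
      by (simp add: g_def poly_const_pow mult.commute flip: power_mult)
    have h4: "[:(\<gamma> ^ 4) ^ (q * j):] = h ^ 4"
      by (simp add: h_def poly_const_pow mult.commute flip: power_mult)
    have T: "[:\<theta> j:] = g - h"
      by (simp add: \<theta> g_def h_def)
    have "(\<Prod>l = 0..1. pm (Y ^ 2 - [:(-1) ^ l * w:]) ([:i ^ l * c * \<theta> j:] * Y))
        = pm (Y ^ 2 - [:w:]) ([:c * \<theta> j:] * Y) * pm (Y ^ 2 - [:- w:]) ([:i * c * \<theta> j:] * Y)"
    proof -
      have "{0..1::nat} = {0, 1}" by auto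
      thus ?thesis by (simp only:) simp
    qed
    also have "\<dots> = pm (Y ^ 2 - C ^ 2) (C * (g - h) * Y) * pm (Y ^ 2 + C ^ 2) (I * C * (g - h) * Y)"
      unfolding const_poly_ring_hom(1,3) W T by (simp add: C_def I_def)
    also have "\<dots> = ((Y ^ 2) ^ 2 - (C ^ 2) ^ 2 * g ^ 4) * ((Y ^ 2) ^ 2 - (C ^ 2) ^ 2 * h ^ 4)"
      unfolding pm_def by (rule high_block_identity[OF gh I])
    also have "\<dots> = ((Y ^ 2) ^ 2 - [:w\<^sup>2 * (\<gamma> ^ 4) ^ j:]) * ((Y ^ 2) ^ 2 - [:w\<^sup>2 * (\<gamma> ^ 4) ^ (q * j):])"
      unfolding const_poly_ring_hom(1) g4 h4 unfolding const_poly_ring_hom(4) W ..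
    finally show ?thesis .
  qed
  have "pm (Y ^ 2) [:w:] = (Y ^ 2) ^ 2 - [:w\<^sup>2:]"
    by (simp add: pm_def power2_eq_square algebra_simps)
  hence "pm (Y ^ 2) [:w:] * (\<Prod>j = 1..(d - 1) div 2. \<Prod>l = 0..1.
             pm (Y ^ 2 - [:(-1) ^ l * w:]) ([:i ^ l * c * \<theta> j:] * Y))
      = ((Y ^ 2) ^ 2) ^ d - [:(w\<^sup>2) ^ d:]"
    unfolding quad
    using prod_minus_roots_of_unity_pairs[OF \<gamma>4 \<open>odd d\<close> \<open>d dvd q + 1\<close>, where X = "(Y ^ 2) ^ 2" and y = "w\<^sup>2"]
    by simp
  thus ?thesis by (simp only: power_mult)
qed

section \<open>Irreducibility over the base field of each type of displayed factor\<close>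

lemma primitive_root_of_unity_hom:
  assumes "field_hom \<iota>" and "primitive_root_of_unity m z"
  shows "primitive_root_of_unity m (\<iota> z)"
proof -
  interpret field_hom \<iota> by fact
  show ?thesis
    using assms(2) by (simp add: primitive_root_of_unity_def flip: hom_power)
qed

text \<open>The roots are \<open>- c * \<gamma> ^ j\<close> and
  \<open>- c * \<gamma> ^ (q * j)\<close>, swapped by the power map because \<open>c\<close> is
  fixed and \<open>q\<close> is odd. If they coincided, the odd number \<open>d\<close> would divide
  \<open>2 * j\<close> and hence \<open>j\<close>, which is too small.\<close>

lemma descends_to_irreducible_low_quadratic:
  fixes \<iota> :: "'a::{field,finite} \<Rightarrow> 'b::{field,finite}"
  assumes "field_hom \<iota>" and "primepow q" and "CARD('a) = q" "CARD('b) = q ^ k"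
    and \<gamma>: "primitive_root_of_unity d \<gamma>" and "odd d" and dvd: "d dvd q + 1" and "odd q"
    and \<delta>: "\<And>j. \<delta> j = \<gamma> ^ j + \<gamma> ^ (q * j)"
    and c: "c ^ q = c" "c \<noteq> 0" and j: "j \<in> {1..(d - 1) div 2}"
  shows "descends_to_irreducible \<iota> (polyx ^ 2 + [:c\<^sup>2:] + [:c * \<delta> j:] * polyx)"
proof -
  note conj = primitive_root_of_unity_mult_conjugate[OF \<gamma> dvd]
  note twice = primitive_root_of_unity_conjugate_twice[OF \<gamma> dvd]
  have ne: "\<gamma> ^ j \<noteq> \<gamma> ^ (q * j)"
  proof
    assume "\<gamma> ^ j = \<gamma> ^ (q * j)"
    hence "\<gamma> ^ (2 * j) = 1"
      using conj[of j] by (simp add: mult_2 power_add)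
    hence "d dvd 2 * j"
      by (simp add: primitive_root_of_unity_power_eq_1_iff[OF \<gamma>])
    hence "d dvd j"
      using \<open>odd d\<close> by (simp add: coprime_dvd_mult_right_iff)
    with j show False by (auto dest!: dvd_imp_le)
  qed
  have "descends_to_irreducible \<iota> ((polyx - [:- c * \<gamma> ^ j:]) * (polyx - [:- c * \<gamma> ^ (q * j):]))"
  proof (rule descends_to_irreducible_quadratic[OF assms(1-4)])
    show "(- c * \<gamma> ^ j) ^ q = - c * \<gamma> ^ (q * j)"
      using \<open>odd q\<close> c by (simp add: power_minus_odd power_mult_distrib mult.commute flip: power_mult)
    have "(- c * \<gamma> ^ (q * j)) ^ q = - c * \<gamma> ^ (q * (q * j))"
      using \<open>odd q\<close> c
      by (simp add: power_minus_odd power_mult_distrib mult.commute mult.left_commute flip: power_mult)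
    thus "(- c * \<gamma> ^ (q * j)) ^ q = - c * \<gamma> ^ j"
      by (simp only: twice)
    show "- c * \<gamma> ^ j \<noteq> - c * \<gamma> ^ (q * j)"
      using ne c by simp
  qed
  also have "(polyx - [:- c * \<gamma> ^ j:]) * (polyx - [:- c * \<gamma> ^ (q * j):])
      = polyx ^ 2 + [:c\<^sup>2:] + [:c * \<delta> j:] * polyx"
    unfolding low_quadratic_eq[OF \<gamma> dvd \<delta>] by simp
  finally show ?thesis .
qed

lemma descends_to_irreducible_binomial:
  fixes \<iota> :: "'a::field \<Rightarrow> 'b::field"
  assumes "field_hom \<iota>" and "(i::'a)\<^sup>2 = -1" and "\<And>v. v\<^sup>2 \<noteq> w"
  shows "descends_to_irreducible \<iota> (polyx ^ 2 ^ r + [:\<iota> w:])"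
proof -
  have "descends_to_irreducible \<iota> (pcompose (polyx + [:\<iota> w:]) (polyx ^ 2 ^ r))"
    by (rule descends_to_irreducible_pcompose_two_power[where i = i and w = w])
       (use assms in \<open>simp_all add: descends_to_irreducible_linear del: add_pCons\<close>)
  thus ?thesis
    by (simp add: pcompose_add pcompose_pCons del: add_pCons)
qed

text \<open>For \<open>r = 1\<close> the roots are \<open>- c * \<gamma> ^ j\<close> and
  \<open>c * \<gamma> ^ (q * j)\<close>; they are swapped because \<open>c ^ q = - c\<close>. Their
  product \<open>- (c ^ 2)\<close> is the image of a nonsquare, which permits the substitution of
  \<open>x ^ 2 ^ (r - 1)\<close>.\<close>

lemma descends_to_irreducible_high_trinomial:
  fixes \<iota> :: "'a::{field,finite} \<Rightarrow> 'b::{field,finite}"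
  assumes "field_hom \<iota>" and "primepow q" and "CARD('a) = q" "CARD('b) = q ^ k"
    and \<gamma>: "primitive_root_of_unity d \<gamma>" and "odd d" and dvd: "d dvd q + 1" and "odd q"
    and \<theta>: "\<And>j. \<theta> j = \<gamma> ^ j - \<gamma> ^ (q * j)"
    and c: "c ^ q = - c" "c \<noteq> 0" and imag: "(i::'a)\<^sup>2 = -1" and char: "(-1::'b) \<noteq> 1"
    and w: "\<iota> w = - c\<^sup>2" "\<And>v. v\<^sup>2 \<noteq> w" and r: "r \<ge> 1"
  shows "descends_to_irreducible \<iota>
           (polyx ^ 2 ^ r - [:c\<^sup>2:] + [:c * \<theta> j:] * polyx ^ 2 ^ (r - 1))"
proof -
  note conj = primitive_root_of_unity_mult_conjugate[OF \<gamma> dvd]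
  note twice = primitive_root_of_unity_conjugate_twice[OF \<gamma> dvd]
  \<comment> \<open>Raising an equality to the odd power \<open>d\<close> would turn the left side
    into -1 and the right side into 1.\<close>
  have ne: "- (\<gamma> ^ j) \<noteq> \<gamma> ^ (q * j)"
  proof
    assume "- (\<gamma> ^ j) = \<gamma> ^ (q * j)"
    hence "(- (\<gamma> ^ j)) ^ d = (\<gamma> ^ (q * j)) ^ d" by simp
    hence "- ((\<gamma> ^ d) ^ j) = (\<gamma> ^ d) ^ (q * j)"
      using \<open>odd d\<close> by (simp add: power_minus_odd mult.commute flip: power_mult)
    thus False
      using \<gamma> char by (simp add: primitive_root_of_unity_def)
  qed
  have "descends_to_irreducible \<iota> ((polyx - [:- c * \<gamma> ^ j:]) * (polyx - [:c * \<gamma> ^ (q * j):]))"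
  proof (rule descends_to_irreducible_quadratic[OF assms(1-4)])
    show "(- c * \<gamma> ^ j) ^ q = c * \<gamma> ^ (q * j)"
      using \<open>odd q\<close> c by (simp add: power_minus_odd power_mult_distrib mult.commute flip: power_mult)
    have "(c * \<gamma> ^ (q * j)) ^ q = - c * \<gamma> ^ (q * (q * j))"
      using c by (simp add: power_mult_distrib mult.commute mult.left_commute flip: power_mult)
    thus "(c * \<gamma> ^ (q * j)) ^ q = - c * \<gamma> ^ j"
      by (simp only: twice)
    have "c * (- (\<gamma> ^ j)) \<noteq> c * \<gamma> ^ (q * j)"
      using ne c by (simp del: mult_minus_right)
    thus "- c * \<gamma> ^ j \<noteq> c * \<gamma> ^ (q * j)"
      by simp
  qed
  also have "(polyx - [:- c * \<gamma> ^ j:]) * (polyx - [:c * \<gamma> ^ (q * j):])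
      = polyx ^ 2 - [:c\<^sup>2:] + [:c * \<theta> j:] * polyx"
  proof -
    have "c * (c * (\<gamma> ^ j * \<gamma> ^ (q * j))) = c * c"
      unfolding conj by simp
    thus ?thesis
      by (simp add: \<theta> power2_eq_square algebra_simps)
  qed
  finally have "descends_to_irreducible \<iota> (pcompose (polyx ^ 2 - [:c\<^sup>2:] + [:c * \<theta> j:] * polyx) (polyx ^ 2 ^ (r - 1)))"
    by (rule descends_to_irreducible_pcompose_two_power[OF assms(1) _ imag, where w = w])
       (use w in \<open>simp_all add: power2_eq_square\<close>)
  also have "pcompose (polyx ^ 2 - [:c\<^sup>2:] + [:c * \<theta> j:] * polyx) (polyx ^ 2 ^ (r - 1))
      = polyx ^ (2 ^ (r - 1) * 2) - [:c\<^sup>2:] + [:c * \<theta> j:] * polyx ^ 2 ^ (r - 1)"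
    by (simp only: pcompose_add pcompose_diff pcompose_mult pcompose_const pcompose_hom.hom_power
        power_mult) (simp add: pcompose_pCons)
  also have "2 ^ (r - 1) * 2 = (2::nat) ^ r"
    using r by (cases r) simp_all
  finally show ?thesis .
qed

section \<open>Displayed products as products of multisets of factors, and their values\<close>

lemma prod_mset_factors_low:
  "prod_mset (factors_low a \<delta> d n) =
     (polyx - 1) * (polyx + 1)
     * (\<Prod>j = 1..(d - 1) div 2. pm (polyx ^ 2 + 1) ([:\<delta> j:] * polyx))
     * (\<Prod>k = 2..n. \<Prod>i = 1..2 ^ (k - 2).
          pm polyx [:a k ^ (2 * i - 1):]
          * (\<Prod>j = 1..(d - 1) div 2.
               pm (polyx ^ 2 + [:a (k - 1) ^ (2 * i - 1):])
                  ([:a k ^ (2 * i - 1) * \<delta> j:] * polyx)))"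
  by (simp only: factors_low_def prod_mset_sum prod_mset_Un prod_mset_pm_factors prod_mset.add_mset
      prod_mset_empty mult_1_right)

lemma prod_mset_factors_high:
  "prod_mset (factors_high a \<beta> \<theta> d s n) =
     (\<Prod>r = 1..n - s. \<Prod>i = 1..2 ^ (s - 2).
        pm (polyx ^ (2 ^ r)) [:a s ^ (2 * i - 1):]
        * (\<Prod>j = 1..(d - 1) div 2. \<Prod>l = 0..1.
             pm (polyx ^ (2 ^ r) - [:a 1 ^ l * a s ^ (2 * i - 1):])
                ([:a 2 ^ l * \<beta> ^ (2 * i - 1) * \<theta> j:] * polyx ^ (2 ^ (r - 1)))))"
  by (simp only: factors_high_def prod_mset_sum prod_mset_Un prod_mset_pm_factors)

text \<open>At level \<open>k\<close> each \<open>i\<close> contributes \<open>x ^ (2 * d)\<close>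
  minus an odd power of \<open>a (k - 1) ^ d\<close>, a primitive root of order
  \<open>2 ^ (k - 1)\<close> because \<open>d\<close> is odd. So the level multiplies to
  \<open>(x ^ (2 * d)) ^ 2 ^ (k - 2) + 1\<close>, and the levels telescope.\<close>

lemma prod_factors_low:
  fixes a :: "nat \<Rightarrow> 'b::field"
  assumes \<gamma>: "primitive_root_of_unity d \<gamma>" and "odd d" and dvd: "d dvd q + 1"
    and \<delta>: "\<And>j. \<delta> j = \<gamma> ^ j + \<gamma> ^ (q * j)"
    and prim: "\<And>k. 1 \<le> k \<Longrightarrow> k \<le> n \<Longrightarrow> primitive_root_of_unity (2 ^ k) (a k)"
    and sq: "\<And>k. 2 \<le> k \<Longrightarrow> k \<le> n \<Longrightarrow> a (k - 1) = (a k)\<^sup>2" and "n \<ge> 2"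
  shows "prod_mset (factors_low a \<delta> d n) = polyx ^ (2 ^ n * d) - 1"
proof -
  note block = prod_low_block[OF \<gamma> \<open>odd d\<close> dvd \<delta>]
  \<comment> \<open>The initial factors are the block with \<open>c = 1\<close>.\<close>
  have first: "(polyx - 1) * (polyx + 1)
      * (\<Prod>j = 1..(d - 1) div 2. pm (polyx ^ 2 + 1) ([:\<delta> j:] * polyx)) = polyx ^ (2 * d) - 1"
  proof -
    have one: "[:1:] = (1 :: 'b poly)" by (simp add: one_pCons)
    have "pm polyx 1 = (polyx - 1) * (polyx + 1 :: 'b poly)"
      unfolding pm_def by (rule mult.commute)
    thus ?thesis
      using block[of 1] by (simp only: power_one one mult_1_left)
  qed
  have level: "(\<Prod>i = 1..2 ^ (k - 2). pm polyx [:a k ^ (2 * i - 1):]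
      * (\<Prod>j = 1..(d - 1) div 2. pm (polyx ^ 2 + [:a (k - 1) ^ (2 * i - 1):])
             ([:a k ^ (2 * i - 1) * \<delta> j:] * polyx)))
      = (polyx ^ (2 * d)) ^ 2 ^ (k - 2) + 1" if k: "k \<in> {2..n}" for k
  proof -
    have "coprime d (2 ^ (k - 1))"
      using \<open>odd d\<close> by simp
    hence b: "primitive_root_of_unity (2 ^ (k - 1)) (a (k - 1) ^ d)"
      using k by (intro primitive_root_of_unity_power_coprime prim) auto
    have "pm polyx [:a k ^ (2 * i - 1):]
      * (\<Prod>j = 1..(d - 1) div 2. pm (polyx ^ 2 + [:a (k - 1) ^ (2 * i - 1):])
             ([:a k ^ (2 * i - 1) * \<delta> j:] * polyx))
      = polyx ^ (2 * d) - [:(a (k - 1) ^ d) ^ (2 * i - 1):]" for i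
    proof -
      have "a (k - 1) ^ (2 * i - 1) = (a k ^ (2 * i - 1))\<^sup>2"
        using sq[of k] k by (simp add: mult.commute flip: power_mult)
      moreover have "(a (k - 1) ^ d) ^ (2 * i - 1) = (a k ^ (2 * i - 1)) ^ (2 * d)"
        using sq[of k] k by (simp add: mult_ac flip: power_mult)
      ultimately show ?thesis
        by (simp only: block)
    qed
    hence "(\<Prod>i = 1..2 ^ (k - 2). pm polyx [:a k ^ (2 * i - 1):]
      * (\<Prod>j = 1..(d - 1) div 2. pm (polyx ^ 2 + [:a (k - 1) ^ (2 * i - 1):])
             ([:a k ^ (2 * i - 1) * \<delta> j:] * polyx)))
      = (\<Prod>i = 1..2 ^ (k - 1 - 1). polyx ^ (2 * d) - [:(a (k - 1) ^ d) ^ (2 * i - 1):])"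
      by (simp add: numeral_2_eq_2)
    also have "\<dots> = (polyx ^ (2 * d)) ^ 2 ^ (k - 1 - 1) + 1"
      using k by (intro prod_minus_odd_powers b) auto
    finally show ?thesis by (simp add: numeral_2_eq_2)
  qed
  have "prod_mset (factors_low a \<delta> d n)
      = (polyx ^ (2 * d) - 1) * (\<Prod>k = 2..n. (polyx ^ (2 * d)) ^ 2 ^ (k - 2) + 1)"
    unfolding prod_mset_factors_low first by (simp only: level cong: prod.cong)
  also have "(\<Prod>k = 2..n. (polyx ^ (2 * d)) ^ 2 ^ (k - 2) + 1 :: 'b poly)
      = (\<Prod>k<n - 1. (polyx ^ (2 * d)) ^ 2 ^ k + 1)"
    by (rule prod.reindex_bij_witness[of _ "\<lambda>k. k + 2" "\<lambda>k. k - 2"]) auto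
  also have "(polyx ^ (2 * d) - 1) * \<dots> = (polyx ^ (2 * d)) ^ 2 ^ (n - 1) - 1"
    by (rule prod_two_power_plus_1)
  also have "(polyx ^ (2 * d)) ^ 2 ^ (n - 1) = (polyx :: 'b poly) ^ (2 * 2 ^ (n - 1) * d)"
    by (simp add: mult_ac flip: power_mult)
  also have "2 * 2 ^ (n - 1) = (2::nat) ^ n"
    using \<open>n \<ge> 2\<close> by (cases n) simp_all
  finally show ?thesis .
qed

text \<open>As in the low case, but with the primitive root \<open>(a s ^ 2) ^ d\<close> of order
  \<open>2 ^ (s - 1)\<close> at every level. Level \<open>r\<close> multiplies to
  \<open>(x ^ (2 ^ s * d)) ^ 2 ^ (r - 1) + 1\<close>, and the levels telescope starting from
  \<open>x ^ (2 ^ s * d) - 1\<close>.\<close>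

lemma prod_factors_high:
  fixes a :: "nat \<Rightarrow> 'b::field"
  assumes \<gamma>: "primitive_root_of_unity d \<gamma>" and "odd d" and dvd: "d dvd q + 1"
    and \<theta>: "\<And>j. \<theta> j = \<gamma> ^ j - \<gamma> ^ (q * j)"
    and prim: "primitive_root_of_unity (2 ^ s) (a s)" and "s \<ge> 2" and "s < n"
    and a1: "a 1 = -1" and a2: "(a 2)\<^sup>2 = -1" and \<beta>: "\<beta>\<^sup>2 = a s"
  shows "(polyx ^ (2 ^ s * d) - 1) * prod_mset (factors_high a \<beta> \<theta> d s n)
           = polyx ^ (2 ^ n * d) - 1"
proof -
  have s: "2 * 2 ^ (s - 2) = (2::nat) ^ (s - 1)" "2 ^ (s - 1) * 2 = (2::nat) ^ s" 
    using \<open>s \<ge> 2\<close> by (auto simp: le_iff_add)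
  have "coprime d (2 ^ (s - 1))"
    using \<open>odd d\<close> by simp
  moreover have "primitive_root_of_unity (2 ^ (s - 1)) ((a s)\<^sup>2)"
    using prim unfolding s(2)[symmetric] by (rule primitive_root_of_unity_power_dvd)
  ultimately have b: "primitive_root_of_unity (2 ^ (s - 1)) (((a s)\<^sup>2) ^ d)"
    by (metis primitive_root_of_unity_power_coprime)
  have level: "(\<Prod>i = 1..2 ^ (s - 2). pm (polyx ^ (2 ^ r)) [:a s ^ (2 * i - 1):]
        * (\<Prod>j = 1..(d - 1) div 2. \<Prod>l = 0..1.
             pm (polyx ^ (2 ^ r) - [:a 1 ^ l * a s ^ (2 * i - 1):])
                ([:a 2 ^ l * \<beta> ^ (2 * i - 1) * \<theta> j:] * polyx ^ (2 ^ (r - 1)))))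
      = (polyx ^ (2 ^ s * d)) ^ 2 ^ (r - 1) + 1" if r: "r \<in> {1..n - s}" for r
  proof -
    \<comment> \<open>The block is used with \<open>Y = polyx ^ 2 ^ (r - 1)\<close>, so that
      \<open>Y ^ 2 = polyx ^ 2 ^ r\<close>; this needs \<open>r\<close> to be at least 1.\<close>
    have r2: "2 ^ r = 2 ^ (r - 1) * (2::nat)"
      using r by (cases r) simp_all
    have "pm (polyx ^ (2 ^ r)) [:a s ^ (2 * i - 1):]
        * (\<Prod>j = 1..(d - 1) div 2. \<Prod>l = 0..1.
             pm (polyx ^ (2 ^ r) - [:a 1 ^ l * a s ^ (2 * i - 1):])
                ([:a 2 ^ l * \<beta> ^ (2 * i - 1) * \<theta> j:] * polyx ^ (2 ^ (r - 1))))
        = (polyx ^ 2 ^ r) ^ (2 * d) - [:(((a s)\<^sup>2) ^ d) ^ (2 * i - 1):]" for i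
    proof -
      have "(\<beta> ^ (2 * i - 1))\<^sup>2 = a s ^ (2 * i - 1)"
        by (simp add: mult.commute flip: \<beta> power_mult)
      note prod_high_block[OF \<gamma> \<open>odd d\<close> dvd \<theta> this a2, of "polyx ^ 2 ^ (r - 1)"]
      moreover have "(((a s)\<^sup>2) ^ d) ^ (2 * i - 1) = (a s ^ (2 * i - 1)) ^ (2 * d)"
        by (simp add: mult_ac flip: power_mult)
      ultimately show ?thesis
        unfolding a1 by (simp only: r2 power_mult)
    qed
    hence "(\<Prod>i = 1..2 ^ (s - 2). pm (polyx ^ (2 ^ r)) [:a s ^ (2 * i - 1):]
        * (\<Prod>j = 1..(d - 1) div 2. \<Prod>l = 0..1.
             pm (polyx ^ (2 ^ r) - [:a 1 ^ l * a s ^ (2 * i - 1):])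
                ([:a 2 ^ l * \<beta> ^ (2 * i - 1) * \<theta> j:] * polyx ^ (2 ^ (r - 1)))))
      = (\<Prod>i = 1..2 ^ (s - 1 - 1). (polyx ^ 2 ^ r) ^ (2 * d) - [:(((a s)\<^sup>2) ^ d) ^ (2 * i - 1):])"
      by (simp add: numeral_2_eq_2)
    also have "\<dots> = ((polyx ^ 2 ^ r) ^ (2 * d)) ^ 2 ^ (s - 1 - 1) + 1"
      using \<open>s \<ge> 2\<close> by (intro prod_minus_odd_powers b) auto
    also have "((polyx ^ 2 ^ r) ^ (2 * d)) ^ 2 ^ (s - 1 - 1)
        = (polyx :: 'b poly) ^ (2 ^ r * (2 * d) * 2 ^ (s - 1 - 1))"
      by (simp only: power_mult)
    also have "2 ^ r * (2 * d) * 2 ^ (s - 1 - 1) = 2 ^ s * d * 2 ^ (r - 1)"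
      using \<open>s \<ge> 2\<close> r by (auto simp: le_iff_add power_add)
    finally show ?thesis by (simp only: power_mult)
  qed
  have "(polyx ^ (2 ^ s * d) - 1) * prod_mset (factors_high a \<beta> \<theta> d s n)
      = (polyx ^ (2 ^ s * d) - 1) * (\<Prod>r = 1..n - s. (polyx ^ (2 ^ s * d)) ^ 2 ^ (r - 1) + 1)"
    unfolding prod_mset_factors_high by (simp only: level cong: prod.cong)
  also have "(\<Prod>r = 1..n - s. (polyx ^ (2 ^ s * d)) ^ 2 ^ (r - 1) + 1 :: 'b poly)
      = (\<Prod>r<n - s. (polyx ^ (2 ^ s * d)) ^ 2 ^ r + 1)"
    by (rule prod.reindex_bij_witness[of _ Suc "\<lambda>r. r - 1"]) auto
  also have "(polyx ^ (2 ^ s * d) - 1) * \<dots> = (polyx ^ (2 ^ s * d)) ^ 2 ^ (n - s) - 1"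
    by (rule prod_two_power_plus_1)
  also have "(polyx ^ (2 ^ s * d)) ^ 2 ^ (n - s) = (polyx :: 'b poly) ^ (2 ^ s * 2 ^ (n - s) * d)"
    by (simp only: mult_ac flip: power_mult)
  also have "2 ^ s * 2 ^ (n - s) = (2::nat) ^ n"
    using \<open>s < n\<close> by (simp flip: power_add)
  finally show ?thesis .
qed

theorem theorem4p2:
  fixes \<iota> :: "'a::{field,finite} \<Rightarrow> 'b::{field,finite}"
    and q d s n :: nat
    and \<alpha> :: "nat \<Rightarrow> 'a"
    and \<beta> \<gamma> :: 'b
    and \<delta> \<theta> :: "nat \<Rightarrow> 'b"
  assumes "primepow q" and "[q = 1] (mod 4)"
    and "CARD('a) = q" and "CARD('b) = q ^ 2" and "field_hom \<iota>"
    and "odd d" and "[int q = - 1] (mod int d)"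
    and "s = multiplicity 2 (q - 1)"
    and "primitive_root_of_unity (2 ^ s) (\<alpha> s)"
    and "\<And>k. 1 \<le> k \<Longrightarrow> k \<le> s \<Longrightarrow> \<alpha> k = \<alpha> s ^ (2 ^ (s - k))"
    and "\<beta> ^ 2 = \<iota> (\<alpha> s)"
    and "primitive_root_of_unity d \<gamma>"
    and "\<And>j. \<delta> j = \<gamma> ^ j + \<gamma> ^ (q * j)"
    and "\<And>j. \<theta> j = \<gamma> ^ j - \<gamma> ^ (q * j)"
  shows "(2 \<le> n \<and> n \<le> s \<longrightarrow>
      polyx ^ (2 ^ n * d) - 1 =
        (polyx - 1) * (polyx + 1)
        * (\<Prod>j = 1..(d - 1) div 2. pm (polyx ^ 2 + 1) ([:\<delta> j:] * polyx))
        * (\<Prod>k = 2..n. \<Prod>i = 1..2 ^ (k - 2).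
             pm polyx [:\<iota> (\<alpha> k) ^ (2 * i - 1):]
             * (\<Prod>j = 1..(d - 1) div 2.
                  pm (polyx ^ 2 + [:\<iota> (\<alpha> (k - 1)) ^ (2 * i - 1):])
                     ([:\<iota> (\<alpha> k) ^ (2 * i - 1) * \<delta> j:] * polyx)))
      \<and> monic_irreducible_factorization \<iota> (polyx ^ (2 ^ n * d) - 1)
          (factors_low (\<lambda>k. \<iota> (\<alpha> k)) \<delta> d n)
          (2 ^ (n - 1) * (d + 1)))
    \<and> (s < n \<longrightarrow>
      polyx ^ (2 ^ n * d) - 1 =
        (polyx ^ (2 ^ s * d) - 1)
        * (\<Prod>r = 1..n - s. \<Prod>i = 1..2 ^ (s - 2).
             pm (polyx ^ (2 ^ r)) [:\<iota> (\<alpha> s) ^ (2 * i - 1):]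
             * (\<Prod>j = 1..(d - 1) div 2. \<Prod>l = 0..1.
                  pm (polyx ^ (2 ^ r) - [:\<iota> (\<alpha> 1) ^ l * \<iota> (\<alpha> s) ^ (2 * i - 1):])
                     ([:\<iota> (\<alpha> 2) ^ l * \<beta> ^ (2 * i - 1) * \<theta> j:] * polyx ^ (2 ^ (r - 1)))))
      \<and> monic_irreducible_factorization \<iota> (polyx ^ (2 ^ n * d) - 1)
          (factors_low (\<lambda>k. \<iota> (\<alpha> k)) \<delta> d s + factors_high (\<lambda>k. \<iota> (\<alpha> k)) \<beta> \<theta> d s n)
          (2 ^ (s - 1) * ((n - s + 1) * d + 1)))"
proof -
  interpret field_hom \<iota> by fact
  interpret map_poly_hom: map_poly_inj_idom_hom \<iota> ..
  note card = assms(3,4) and \<alpha>_prim = assms(9) and \<alpha> = assms(10) and \<beta> = assms(11)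
    and \<gamma> = assms(12) and \<delta> = assms(13) and \<theta> = assms(14)

  \<comment> \<open>Arithmetic of \<open>q - 1\<close>, nonsquares, and the action of the
    \<open>q\<close>-th power map\<close>
  have "q > 1"
    using \<open>primepow q\<close> by (rule primepow_gt_Suc_0[unfolded One_nat_def[symmetric]])
  have "4 dvd q - 1"
    using \<open>[q = 1] (mod 4)\<close> by (rule cong_to_1_nat)
  hence "odd q"
    using \<open>q > 1\<close> by presburger
  have "2 ^ 2 dvd q - 1"
    using \<open>4 dvd q - 1\<close> by simp
  hence "s \<ge> 2"
    unfolding \<open>s = multiplicity 2 (q - 1)\<close> using \<open>q > 1\<close> by (intro multiplicity_geI) auto
  have dvd: "d dvd q + 1"
  proof -
    have "int d dvd int (q + 1)"
      using \<open>[int q = - 1] (mod int d)\<close> by (simp add: cong_iff_dvd_diff add.commute)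
    thus ?thesis by (simp only: int_dvd_int_iff)
  qed
  obtain t where t: "q - 1 = 2 ^ s * t" "odd t"
    using multiplicity_decompose'[of "q - 1" 2] \<open>q > 1\<close> \<open>s = multiplicity 2 (q - 1)\<close>
    by (auto simp: mult.commute)
  \<comment> \<open>In this form \<open>v ^ q\<close> becomes \<open>v\<close> times a power of
    \<open>v ^ 2\<close>, as in Euler's criterion.\<close>
  have q: "q = Suc (2 * (2 ^ (s - 1) * t))"
    using t(1) \<open>q > 1\<close> \<open>s \<ge> 2\<close> by (cases s) (auto simp: mult.assoc)
  have half: "\<alpha> s ^ 2 ^ (s - 1) = -1"
    using \<alpha>_prim \<open>s \<ge> 2\<close> by (intro primitive_root_of_unity_two_power_half) auto
  have neg1_a: "(-1::'a) \<noteq> 1"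
  proof -
    have "(2::nat) ^ (s - 1) < 2 ^ s" using \<open>s \<ge> 2\<close> by simp
    thus ?thesis
      using \<alpha>_prim unfolding half[symmetric] by (auto simp: primitive_root_of_unity_def)
  qed
  have neg1_b: "(-1::'b) \<noteq> 1"
    using neg1_a by (metis hom_one hom_uminus injectivity)
  have \<alpha>_nz: "\<alpha> s \<noteq> 0"
    using \<alpha>_prim by (auto simp: primitive_root_of_unity_def power_0_left)
  have fixed: "\<iota> x ^ q = \<iota> x" for x
    using finite_field_power_card[of x] by (simp add: card(1) flip: hom_power)
  \<comment> \<open>If \<open>v ^ 2 = \<alpha> s ^ u\<close>, then \<open>v = v ^ q\<close> equals
    \<open>v\<close> times \<open>(-1) ^ (u * t)\<close>. Both \<open>u\<close> and \<open>t\<close>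
    are odd, so \<open>v = - v\<close> and \<open>v\<close> vanishes, although \<alpha> does
    not.\<close>
  have nonsquare: "v\<^sup>2 \<noteq> \<alpha> s ^ u" if "odd u" for u v
  proof
    assume v: "v\<^sup>2 = \<alpha> s ^ u"
    have "v ^ q = v * (v\<^sup>2) ^ (2 ^ (s - 1) * t)"
      by (subst q) (simp add: power_mult)
    also have "(v\<^sup>2) ^ (2 ^ (s - 1) * t) = (\<alpha> s ^ 2 ^ (s - 1)) ^ (u * t)"
      by (simp add: v mult_ac flip: power_mult)
    also have "\<dots> = -1"
      unfolding half using \<open>odd u\<close> t(2) by simp
    finally have "v = - v"
      using finite_field_power_card[of v] by (simp add: card(1))
    hence "v * (1 - (-1)) = 0"
      by (simp add: algebra_simps)
    hence "v = 0" using neg1_a by (metis eq_iff_diff_eq_0 mult_eq_0_iff)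
    with v \<alpha>_nz show False by simp
  qed
  have nonsquare_neg: "v\<^sup>2 \<noteq> - (\<alpha> s ^ u)" if "odd u" for u v
  proof -
    \<comment> \<open>The sign is absorbed into the exponent, which stays odd because
      \<open>2 ^ (s - 1)\<close> is even for \<open>s\<close> at least 2.\<close>
    have "- (\<alpha> s ^ u) = \<alpha> s ^ (2 ^ (s - 1) + u)"
      by (simp only: power_add half) simp
    moreover have "odd (2 ^ (s - 1) + u)"
      using that \<open>s \<ge> 2\<close> by simp
    ultimately show ?thesis using nonsquare by metis
  qed
  define a where "a = (\<lambda>k. \<iota> (\<alpha> k))"
  have a_prim: "primitive_root_of_unity (2 ^ k) (a k)" if "1 \<le> k" "k \<le> s" for k
  proof -
    have "2 ^ s = (2::nat) ^ k * 2 ^ (s - k)"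
      using that by (simp flip: power_add)
    with \<alpha>_prim have "primitive_root_of_unity (2 ^ k) (\<alpha> k)"
      unfolding \<alpha>[OF that] by (metis primitive_root_of_unity_power_dvd)
    thus ?thesis
      unfolding a_def by (rule primitive_root_of_unity_hom[OF assms(5)])
  qed
  have \<alpha>_sq: "\<alpha> (k - 1) = (\<alpha> k)\<^sup>2" if "2 \<le> k" "k \<le> s" for k
  proof -
    have "(2::nat) ^ (s - (k - 1)) = 2 ^ (s - k) * 2"
      using that by (simp add: Suc_diff_le flip: power_Suc2)
    thus ?thesis
      using that \<alpha>[of k] \<alpha>[of "k - 1"] by (simp add: power_mult)
  qed
  hence a_sq: "a (k - 1) = (a k)\<^sup>2" if "2 \<le> k" "k \<le> s" for k
    using that by (simp add: a_def hom_power)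
  have \<alpha>1: "\<alpha> 1 = -1"
    using \<alpha>[of 1] half \<open>s \<ge> 2\<close> by simp
  have imag: "(\<alpha> 2)\<^sup>2 = -1"
    using \<alpha>_sq[of 2] \<alpha>1 \<open>s \<ge> 2\<close> by simp
  have a1: "a 1 = -1" and a2: "(a 2)\<^sup>2 = -1" and \<beta>_sq: "\<beta>\<^sup>2 = a s"
    using \<alpha>1 imag \<beta> by (simp_all add: a_def hom_uminus flip: hom_power)
  have a_nz: "a k \<noteq> 0" if "1 \<le> k" "k \<le> s" for k
    using a_prim[OF that] by (auto simp: primitive_root_of_unity_def power_0_left)
  \<comment> \<open>The same computation as for nonsquares: \<beta> is a square root of a nonsquare,
    so the power map negates it.\<close>
  have \<beta>_conj: "\<beta> ^ q = - \<beta>"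
  proof -
    have "\<beta> ^ q = \<beta> * (\<beta>\<^sup>2) ^ (2 ^ (s - 1) * t)"
      by (subst q) (simp add: power_mult)
    also have "(\<beta>\<^sup>2) ^ (2 ^ (s - 1) * t) = \<iota> ((\<alpha> s ^ 2 ^ (s - 1)) ^ t)"
      by (simp add: \<beta> hom_power power_mult)
    also have "\<dots> = -1"
      unfolding half using t(2) by (simp add: hom_uminus)
    finally show ?thesis by simp
  qed

  \<comment> \<open>Descent of the individual factors\<close>
  have low: "descends_to_irreducible \<iota> f" if f: "f \<in># factors_low a \<delta> d m" and "m \<le> s" for f m
  proof -
    note quad = descends_to_irreducible_low_quadratic[OF assms(5,1) card \<gamma> \<open>odd d\<close> dvd \<open>odd q\<close> \<delta>]
    \<comment> \<open>The sign of the middle term is switched by passing from \<open>c\<close> to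
      \<open>- c\<close>, which is again fixed since \<open>q\<close> is odd.\<close>
    have quads: "descends_to_irreducible \<iota> (polyx ^ 2 + [:c\<^sup>2:] + [:c * \<delta> j:] * polyx)"
      "descends_to_irreducible \<iota> (polyx ^ 2 + [:c\<^sup>2:] - [:c * \<delta> j:] * polyx)"
      if "c ^ q = c" "c \<noteq> 0" "j \<in> {1..(d - 1) div 2}" for c j
      using quad[OF that] quad[of "- c" j] that \<open>odd q\<close>
      by (simp_all only: power_minus_odd neg_equal_0_iff_equal power2_minus mult_minus_left
          const_poly_ring_hom(3) add_uminus_conv_diff simp_thms)
    have lin: "descends_to_irreducible \<iota> (polyx + [:\<iota> c:])"
      "descends_to_irreducible \<iota> (polyx - [:\<iota> c:])" for c
      using descends_to_irreducible_linear[OF assms(5), of c]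
        descends_to_irreducible_linear[OF assms(5), of "- c"] by (simp_all add: hom_uminus)
    have one: "[:1:] = (1 :: 'b poly)" by (simp add: one_pCons)
    \<comment> \<open>The initial factors are written with \<open>\<iota> 1\<close> and with
      \<open>c = 1\<close>, so that \<open>lin\<close> and \<open>quads\<close> cover them as
      well.\<close>
    consider "f = polyx - [:\<iota> 1:]" | "f = polyx + [:\<iota> 1:]"
      | j where "j \<in> {1..(d - 1) div 2}"
          "f \<in> {polyx ^ 2 + [:1\<^sup>2:] + [:1 * \<delta> j:] * polyx, polyx ^ 2 + [:1\<^sup>2:] - [:1 * \<delta> j:] * polyx}"
      | k i where "k \<in> {2..m}" "f \<in> {polyx + [:a k ^ (2 * i - 1):], polyx - [:a k ^ (2 * i - 1):]}"
      | k i j where "k \<in> {2..m}" "j \<in> {1..(d - 1) div 2}"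
          "f \<in> {polyx ^ 2 + [:a (k - 1) ^ (2 * i - 1):] + [:a k ^ (2 * i - 1) * \<delta> j:] * polyx,
                polyx ^ 2 + [:a (k - 1) ^ (2 * i - 1):] - [:a k ^ (2 * i - 1) * \<delta> j:] * polyx}"
      using f unfolding factors_low_def hom_one power_one mult_1_left one
      by (fastforce simp only: set_mset_union set_mset_sum finite_atLeastAtMost set_pm_factors
          set_mset_add_mset_insert set_mset_empty Un_iff UN_iff insert_iff empty_iff)
    thus ?thesis
    proof cases
      case 1
      thus ?thesis using lin by blast
    next
      case 2
      thus ?thesis using lin by blast
    next
      case 3
      thus ?thesis using quads[of 1] by auto
    next
      case (4 k i)
      thus ?thesis using lin[of "\<alpha> k ^ (2 * i - 1)"] by (auto simp: a_def hom_power)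
    next
      case (5 k i j)
      define c where "c = a k ^ (2 * i - 1)"
      have "c ^ q = c"
        using fixed[of "\<alpha> k ^ (2 * i - 1)"] by (simp add: c_def a_def hom_power)
      moreover have "c \<noteq> 0"
        using a_nz[of k] 5(1) \<open>m \<le> s\<close> by (simp add: c_def)
      moreover have "a (k - 1) ^ (2 * i - 1) = c\<^sup>2"
        using a_sq[of k] 5(1) \<open>m \<le> s\<close> by (simp add: c_def mult.commute flip: power_mult)
      ultimately show ?thesis
        using 5(2,3) quads[of c j] unfolding c_def by auto
    qed
  qed

  have high: "descends_to_irreducible \<iota> f" if f: "f \<in># factors_high a \<beta> \<theta> d s n" for f
  proof -
    consider r i where "i \<in> {1..2 ^ (s - 2)}"
          "f \<in> {polyx ^ 2 ^ r + [:a s ^ (2 * i - 1):], polyx ^ 2 ^ r - [:a s ^ (2 * i - 1):]}"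
      | r i j l where "r \<in> {1..n - s}" "i \<in> {1..2 ^ (s - 2)}" "l \<in> {0..1}"
          "f \<in> {polyx ^ 2 ^ r - [:a 1 ^ l * a s ^ (2 * i - 1):]
                  + [:a 2 ^ l * \<beta> ^ (2 * i - 1) * \<theta> j:] * polyx ^ 2 ^ (r - 1),
                polyx ^ 2 ^ r - [:a 1 ^ l * a s ^ (2 * i - 1):]
                  - [:a 2 ^ l * \<beta> ^ (2 * i - 1) * \<theta> j:] * polyx ^ 2 ^ (r - 1)}"
      using f unfolding factors_high_def
      by (fastforce simp only: set_mset_union set_mset_sum finite_atLeastAtMost set_pm_factors
          Un_iff UN_iff)
    thus ?thesis
    proof cases
      case (1 r i)
      \<comment> \<open>That \<open>i\<close> starts at 1 matters: truncated subtraction would give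
        the even exponent 0 at \<open>i = 0\<close>.\<close>
      hence u: "odd (2 * i - 1)" by auto
      have "descends_to_irreducible \<iota> (polyx ^ 2 ^ r + [:\<iota> (\<alpha> s ^ (2 * i - 1)):])"
        "descends_to_irreducible \<iota> (polyx ^ 2 ^ r + [:\<iota> (- (\<alpha> s ^ (2 * i - 1))):])"
        using assms(5) imag nonsquare[OF u] nonsquare_neg[OF u]
        by (blast intro: descends_to_irreducible_binomial)+
      thus ?thesis
        using 1(2) by (auto simp: a_def hom_power hom_uminus const_poly_ring_hom(3)
            simp del: minus_pCons)
    next
      case (2 r i j l)
      hence u: "odd (2 * i - 1)" by auto
      \<comment> \<open>The power map fixes the power of \<open>a 2\<close> and negates the odd
        power of \<beta>, so \<open>c ^ q = - c\<close>.\<close>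
      define c where "c = a 2 ^ l * \<beta> ^ (2 * i - 1)"
      have c_conj: "c ^ q = - c"
      proof -
        have "(a 2 ^ l) ^ q = a 2 ^ l"
          using fixed[of "\<alpha> 2 ^ l"] by (simp add: a_def hom_power)
        moreover have "(\<beta> ^ (2 * i - 1)) ^ q = - (\<beta> ^ (2 * i - 1))"
          using u by (metis \<beta>_conj mult.commute power_minus_odd power_mult)
        ultimately show ?thesis by (simp add: c_def power_mult_distrib)
      qed
      have "c \<noteq> 0"
        using \<beta>_sq a_nz[of s] a_nz[of 2] \<open>s \<ge> 2\<close> by (auto simp: c_def)
      have c_sq: "c\<^sup>2 = a 1 ^ l * a s ^ (2 * i - 1)"
      proof -
        have "(a 2 ^ l)\<^sup>2 = (-1) ^ l" "(\<beta> ^ (2 * i - 1))\<^sup>2 = a s ^ (2 * i - 1)"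
          by (metis a2 \<beta>_sq mult.commute power_mult)+
        thus ?thesis
          unfolding c_def a1 power_mult_distrib by (simp only:)
      qed
      \<comment> \<open>The constant coefficient \<open>- (c ^ 2)\<close>, written in the base
        field. According to the parity of \<open>l\<close> it is an odd power of
        \<open>\<alpha> s\<close> or its negative, a nonsquare in both cases.\<close>
      define w where "w = - ((-1) ^ l * \<alpha> s ^ (2 * i - 1))"
      have w: "\<iota> w = - c\<^sup>2"
        unfolding c_sq a1 by (simp add: w_def a_def hom_power hom_uminus hom_mult)
      have w_nonsquare: "v\<^sup>2 \<noteq> w" for v
        using nonsquare[OF u] nonsquare_neg[OF u] by (cases "even l") (simp_all add: w_def)
      note tri = descends_to_irreducible_high_trinomial[OF assms(5,1) card \<gamma> \<open>odd d\<close> dvd \<open>odd q\<close> \<theta>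
          _ _ imag neg1_b _ w_nonsquare]
      have "r \<ge> 1" using 2(1) by simp
      have "descends_to_irreducible \<iota> (polyx ^ 2 ^ r - [:c\<^sup>2:] + [:c * \<theta> j:] * polyx ^ 2 ^ (r - 1))"
        by (rule tri) fact+
      \<comment> \<open>The other sign comes from \<open>- c\<close>, which has the same square and
        is also negated by the power map.\<close>
      moreover have "descends_to_irreducible \<iota>
          (polyx ^ 2 ^ r - [:(- c)\<^sup>2:] + [:- c * \<theta> j:] * polyx ^ 2 ^ (r - 1))"
        by (rule tri) (use c_conj \<open>c \<noteq> 0\<close> w \<open>r \<ge> 1\<close> \<open>odd q\<close> in \<open>simp_all add: power_minus_odd\<close>)
      ultimately show ?thesis
        using 2(4) unfolding c_sq[symmetric] c_def[symmetric] by auto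
    qed
  qed

  \<comment> \<open>Products and numbers of factors\<close>
  have prod_low: "prod_mset (factors_low a \<delta> d m) = polyx ^ (2 ^ m * d) - 1"
    if "2 \<le> m" "m \<le> s" for m
    using prod_factors_low[OF \<gamma> \<open>odd d\<close> dvd \<delta>, of m a] a_prim a_sq that by simp
  have prod_high: "(polyx ^ (2 ^ s * d) - 1) * prod_mset (factors_high a \<beta> \<theta> d s n)
      = polyx ^ (2 ^ n * d) - 1" if "s < n"
    using prod_factors_high[OF \<gamma> \<open>odd d\<close> dvd \<theta> a_prim _ that a1 a2 \<beta>_sq] \<open>s \<ge> 2\<close> by simp
  have map: "map_poly \<iota> (polyx ^ k - 1) = polyx ^ k - 1" for k
    by (simp add: map_poly_hom.hom_minus map_poly_hom.hom_power)
  have part1: "polyx ^ (2 ^ n * d) - 1 = prod_mset (factors_low a \<delta> d n)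
      \<and> monic_irreducible_factorization \<iota> (polyx ^ (2 ^ n * d) - 1) (factors_low a \<delta> d n)
          (2 ^ (n - 1) * (d + 1))" if "2 \<le> n \<and> n \<le> s"
  proof
    show "polyx ^ (2 ^ n * d) - 1 = prod_mset (factors_low a \<delta> d n)"
      using prod_low that by simp
    show "monic_irreducible_factorization \<iota> (polyx ^ (2 ^ n * d) - 1) (factors_low a \<delta> d n)
          (2 ^ (n - 1) * (d + 1))"
    proof (rule monic_irreducible_factorizationI[OF assms(5)])
      show "descends_to_irreducible \<iota> f" if "f \<in># factors_low a \<delta> d n" for f
        using low[OF that] \<open>2 \<le> n \<and> n \<le> s\<close> by blast
    qed (use that in \<open>simp_all add: prod_low map size_factors_low \<open>odd d\<close>\<close>)
  qed
  have part2: "polyx ^ (2 ^ n * d) - 1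
        = (polyx ^ (2 ^ s * d) - 1) * prod_mset (factors_high a \<beta> \<theta> d s n)
      \<and> monic_irreducible_factorization \<iota> (polyx ^ (2 ^ n * d) - 1)
          (factors_low a \<delta> d s + factors_high a \<beta> \<theta> d s n)
          (2 ^ (s - 1) * ((n - s + 1) * d + 1))" if "s < n"
  proof
    show "polyx ^ (2 ^ n * d) - 1
        = (polyx ^ (2 ^ s * d) - 1) * prod_mset (factors_high a \<beta> \<theta> d s n)"
      using prod_high that by simp
    show "monic_irreducible_factorization \<iota> (polyx ^ (2 ^ n * d) - 1)
          (factors_low a \<delta> d s + factors_high a \<beta> \<theta> d s n)
          (2 ^ (s - 1) * ((n - s + 1) * d + 1))"
    proof (rule monic_irreducible_factorizationI[OF assms(5)])
      show "descends_to_irreducible \<iota> f" if "f \<in># factors_low a \<delta> d s + factors_high a \<beta> \<theta> d s n" for f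
        using that low[of f s] high by auto
      show "prod_mset (factors_low a \<delta> d s + factors_high a \<beta> \<theta> d s n)
          = map_poly \<iota> (polyx ^ (2 ^ n * d) - 1)"
        using prod_high[OF that] prod_low[of s] \<open>s \<ge> 2\<close> by (simp add: map)
      \<comment> \<open>The two counts are \<open>2 ^ (s - 1) * (d + 1)\<close> and
        \<open>2 ^ (s - 1) * ((n - s) * d)\<close>.\<close>
      show "size (factors_low a \<delta> d s + factors_high a \<beta> \<theta> d s n)
          = 2 ^ (s - 1) * ((n - s + 1) * d + 1)"
        by (simp add: size_factors_low size_factors_high \<open>odd d\<close> \<open>s \<ge> 2\<close> algebra_simps)
    qed
  qed
  show ?thesis
    using part1 part2 unfolding prod_mset_factors_low prod_mset_factors_high unfolding a_def by blast
qed

end
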